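(* Let $\mathcal{H}$ be a real Hilbert space and let $(\mathcal{A},\varepsilon)$ be a probability system. Let $\{G(f): f\in\mathcal{H}\}\subset\mathcal{A}$ be a normalized generalized strong Gaussian process with strongly multiplicative function $t_G:\mathcal{P}_2(\infty)\to\mathbb{C}$, i.e. for all $k\ge 1$ and $f_1,\dots,f_k\in\mathcal{H}$, $$\varepsilon(G(f_1)\cdots G(f_k))=\begin{cases}\displaystyle\sum_{V\in\mathcal{P}_2(2n)}t_G(V)\prod_{(i,j)\in V}\langle f_i|f_j\rangle, & k=2n,\\ 0,& k \text{ odd}.\end{cases}$$ Let $\{G_0(f): f\in\mathcal{H}\}\subset\mathcal{A}$ be a free Gaussian process, and suppose that the families $\{G(f):f\in\mathcal{H}\}$ and $\{G_0(f):f\in\mathcal{H}\}$ are freely independent in $(\mathcal{A},\varepsilon)$. Then for each $0\le b\le 1$ the process $$X_b(f)=\sqrt{b}\,G(f)+\sqrt{1-b}\,G_0(f),\qquad f\in\mathcal{H},$$ is again a generalized strong Gaussian process, and its corresponding strongly multiplicative function is $$t_{X_b}(V)=b^{H(V)}\,t_G(V),\qquad V\in\mathcal{P}_2(2n),\ n\ge 1.$$ That is, $V\mapsto b^{H(V)}t_G(V)$ is strongly multiplicative, and for all $n\ge 1$ and $f_1,\dots,f_{2n}\in\mathcal{H}$, $$\varepsilon(X_b(f_1)X_b(f_2)\cdots X_b(f_{2n}))=\sum_{V\in\mathcal{P}_2(2n)}b^{H(V)}\,t_G(V)\prod_{(i,j)\in V}\langle f_i|f_j\rangle,$$ while all odd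 moments $\varepsilon(X_b(f_1)\cdots X_b(f_{2n+1}))$ are zero.
   Context: $\mathcal{P}_2(2n)$ is the set of pair-partitions of $\{1,\dots,2n\}$ (partitions into $n$ blocks of size two, each block written $(i,j)$ with $i<j$), and $\mathcal{P}_2(\infty)=\bigcup_{n\ge1}\mathcal{P}_2(2n)$. A pair-partition of an arbitrary finite totally ordered set with $2n$ elements is identified with an element of $\mathcal{P}_2(2n)$ through the order-preserving bijection. Two blocks $(i_1,j_1),(i_2,j_2)$ cross if $i_1<i_2<j_1<j_2$ or $i_2<i_1<j_2<j_1$. $V$ is non-crossing if no two of its blocks cross. A block of $V$ is a singleton if it crosses no other block of $V$; $h(V)$ is the number of singletons of $V$, and $H(V)=n-h(V)$ for $V\in\mathcal{P}_2(2n)$. Convention: $0^0=1$. A probability system $(\mathcal{A},\varepsilon)$ is a unital $*$-algebra $\mathcal{A}$ with a state $\varepsilon$. A (normalized) generalized Gaussian process over $\mathcal{H}$ with function $t:\mathcal{P}_2(\infty)\to\mathbb{C}$ is a family $G(f)=G(f)^*\in\mathcal{A}$, $f\in\mathcal{H}$, such that $\varepsilon(G(f_1)\cdots G(f_k))$ equals $0$ for $k$ odd and $\sum_{V\in\mathcal{P}_2(2n)}t(V)\prod_{(i,j)\in V}\langle f_i|f_j\rangle$ for $k=2n$ (in particular, these moments are invariant under $f_i\mapsto O(f_i)$ for orthogonal $O:\mathcal{H}\to\mathcal{H}$), with normalization $t(\{(1,2)\})=1$. The function $t$ is strongly multiplicative if $t(V_1\cup V_2)=t(V_1)t(V_2)$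 whenever $V_1,V_2$ are pair-partitions of disjoint finite sets of integers such that no block of $V_1$ crosses a block of $V_2$. A generalized strong Gaussian process is a generalized Gaussian process whose function $t$ is strongly multiplicative. The free Gaussian process $G_0$ is the generalized Gaussian process with $t_{G_0}(V)=1$ if $V$ is non-crossing and $t_{G_0}(V)=0$ otherwise. Two families are freely independent if the unital subalgebras they generate are free with respect to $\varepsilon$ in the sense of Voiculescu. *)

theory Defs
  imports "HOL-Analysis.Analysis"
begin

section \<open>Pair partitions\<close>

text \<open>A block $(i,j)$ with $i<j$ is the two-element set $\{i,j\}$, so that $i$ and $j$ are
  recovered from it as its minimum and maximum.\<close>

definition pair_partitions :: "'a set \<Rightarrow> 'a set set set" where
  "pair_partitions S = {V. partition_on S V \<and> (\<forall>B\<in>V. card B = 2)}"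

definition crosses :: "'a::linorder set \<Rightarrow> 'a set \<Rightarrow> bool" where
  "crosses B C \<longleftrightarrow>
     (Min B < Min C \<and> Min C < Max B \<and> Max B < Max C) \<or>
     (Min C < Min B \<and> Min B < Max C \<and> Max C < Max B)"

definition noncrossing :: "'a::linorder set set \<Rightarrow> bool" where
  "noncrossing V \<longleftrightarrow> (\<forall>B\<in>V. \<forall>C\<in>V. \<not> crosses B C)"

text \<open>No block crosses itself, so there is no need to exclude $C = B$ below.\<close>

definition singleton_count :: "'a::linorder set set \<Rightarrow> nat" where
  "singleton_count V = card {B\<in>V. \<forall>C\<in>V. \<not> crosses B C}"

definition nonsingleton_count :: "'a::linorder set set \<Rightarrow> nat" where
  "nonsingleton_count V = card V - singleton_count V"

text \<open>Transport of a pair partition of a finite totally ordered set with $2n$ elements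
  (recovered as the union of the blocks) to $\{1,\dots,2n\}$ along the order-preserving
  bijection, which maps each point to its rank.\<close>

definition standardize :: "'a::linorder set set \<Rightarrow> nat set set" where
  "standardize V = (\<lambda>B. (\<lambda>x. card {y\<in>\<Union>V. y \<le> x}) ` B) ` V"

lemma standardize_initial_segment:
  assumes "V \<in> pair_partitions {1..2 * n}"
  shows "standardize V = V"
proof -
  have U: "\<Union>V = {1..2 * n}"
    using assms by (auto simp: pair_partitions_def partition_on_def)
  have r: "card {y\<in>\<Union>V. y \<le> x} = x" if "x \<in> \<Union>V" for x
  proof -
    have "{y\<in>\<Union>V. y \<le> x} = {1..x}" using that by (auto simp: U)
    then show ?thesis by simp
  qed
  have "(\<lambda>x. card {y\<in>\<Union>V. y \<le> x}) ` B = B" if "B \<in> V" for B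
    using r that by (force simp: image_iff)
  then show ?thesis by (simp add: standardize_def)
qed

lemma rank_order_preserving_bij:
  fixes S :: "'a::linorder set"
  assumes "finite S"
  shows "strict_mono_on S (\<lambda>x. card {y\<in>S. y \<le> x})"
    and "bij_betw (\<lambda>x. card {y\<in>S. y \<le> x}) S {1..card S}"
proof -
  show mono: "strict_mono_on S (\<lambda>x. card {y\<in>S. y \<le> x})"
  proof (rule strict_mono_onI)
    fix x z assume "x \<in> S" "z \<in> S" "x < z"
    then have "{y\<in>S. y \<le> x} \<subset> {y\<in>S. y \<le> z}" by force
    then show "card {y\<in>S. y \<le> x} < card {y\<in>S. y \<le> z}"
      using assms by (intro psubset_card_mono) auto
  qed
  have inj: "inj_on (\<lambda>x. card {y\<in>S. y \<le> x}) S"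
    using mono by (rule strict_mono_on_imp_inj_on)
  have sub: "(\<lambda>x. card {y\<in>S. y \<le> x}) ` S \<subseteq> {1..card S}"
  proof safe
    fix x assume "x \<in> S"
    then have "card {x} \<le> card {y\<in>S. y \<le> x}" "card {y\<in>S. y \<le> x} \<le> card S"
      using assms by (intro card_mono; auto)+
    then show "card {y\<in>S. y \<le> x} \<in> {1..card S}" by simp
  qed
  have "(\<lambda>x. card {y\<in>S. y \<le> x}) ` S = {1..card S}"
    using sub by (rule card_subset_eq[rotated]) (simp_all add: card_image inj)
  with inj show "bij_betw (\<lambda>x. card {y\<in>S. y \<le> x}) S {1..card S}"
    by (simp add: bij_betw_def)
qed

text \<open>A weight $t$ matters only at pair partitions of $\{1,\dots,2n\}$ with $n \ge 1$; in
  particular its value at the empty partition is irrelevant, whence the nonemptiness conditions.\<close>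

definition strongly_multiplicative :: "(nat set set \<Rightarrow> complex) \<Rightarrow> bool" where
  "strongly_multiplicative t \<longleftrightarrow>
     (\<forall>(S\<^sub>1::int set) S\<^sub>2 V\<^sub>1 V\<^sub>2.
        finite S\<^sub>1 \<longrightarrow> finite S\<^sub>2 \<longrightarrow> S\<^sub>1 \<noteq> {} \<longrightarrow> S\<^sub>2 \<noteq> {} \<longrightarrow> S\<^sub>1 \<inter> S\<^sub>2 = {} \<longrightarrow>
        V\<^sub>1 \<in> pair_partitions S\<^sub>1 \<longrightarrow> V\<^sub>2 \<in> pair_partitions S\<^sub>2 \<longrightarrow>
        (\<forall>B\<in>V\<^sub>1. \<forall>C\<in>V\<^sub>2. \<not> crosses B C) \<longrightarrow>
        t (standardize (V\<^sub>1 \<union> V\<^sub>2)) = t (standardize V\<^sub>1) * t (standardize V\<^sub>2))"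


section \<open>Probability systems\<close>

locale unital_star_algebra = vector_space scl
  for scl :: "complex \<Rightarrow> 'a::ring_1 \<Rightarrow> 'a" +
  fixes star :: "'a \<Rightarrow> 'a"
  assumes scl_mult_left: "scl c x * y = scl c (x * y)"
    and scl_mult_right: "x * scl c y = scl c (x * y)"
    and star_add: "star (x + y) = star x + star y"
    and star_scl: "star (scl c x) = scl (cnj c) (star x)"
    and star_mult: "star (x * y) = star y * star x"
    and star_star: "star (star x) = x"

locale probability_system = unital_star_algebra scl star
  for scl :: "complex \<Rightarrow> 'a::ring_1 \<Rightarrow> 'a" and star :: "'a \<Rightarrow> 'a" +
  fixes \<epsilon> :: "'a \<Rightarrow> complex"
  assumes state_linear: "Vector_Spaces.linear scl (*) \<epsilon>"
    and state_nonneg: "\<epsilon> (star x * x) \<in> \<real>\<^sub>\<ge>\<^sub>0"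
    and state_one: "\<epsilon> 1 = 1"

inductive_set generated_subalgebra :: "(complex \<Rightarrow> 'a::ring_1 \<Rightarrow> 'a) \<Rightarrow> 'a set \<Rightarrow> 'a set"
  for scl :: "complex \<Rightarrow> 'a \<Rightarrow> 'a" and S :: "'a set" where
  generator: "x \<in> S \<Longrightarrow> x \<in> generated_subalgebra scl S"
| one: "1 \<in> generated_subalgebra scl S"
| add: "\<lbrakk>x \<in> generated_subalgebra scl S; y \<in> generated_subalgebra scl S\<rbrakk>
    \<Longrightarrow> x + y \<in> generated_subalgebra scl S"
| mult: "\<lbrakk>x \<in> generated_subalgebra scl S; y \<in> generated_subalgebra scl S\<rbrakk>
    \<Longrightarrow> x * y \<in> generated_subalgebra scl S"
| scaled: "x \<in> generated_subalgebra scl S \<Longrightarrow> scl c x \<in> generated_subalgebra scl S"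

text \<open>Freeness in the sense of Voiculescu: an alternating product of centred elements of the
  generated unital subalgebras is centred.\<close>

definition freely_independent ::
  "(complex \<Rightarrow> 'a::ring_1 \<Rightarrow> 'a) \<Rightarrow> ('a \<Rightarrow> complex) \<Rightarrow> ('i \<Rightarrow> 'a set) \<Rightarrow> bool" where
  "freely_independent scl \<epsilon> S \<longleftrightarrow>
     (\<forall>n\<ge>1. \<forall>(c :: nat \<Rightarrow> 'i) a.
        (\<forall>j<n. a j \<in> generated_subalgebra scl (S (c j)) \<and> \<epsilon> (a j) = 0) \<longrightarrow>
        (\<forall>j. Suc j < n \<longrightarrow> c j \<noteq> c (Suc j)) \<longrightarrow>
        \<epsilon> (prod_list (map a [0..<n])) = 0)"


section \<open>Generalized Gaussian processes\<close>

definition gaussian_process ::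
  "('a::ring_1 \<Rightarrow> 'a) \<Rightarrow> ('a \<Rightarrow> complex) \<Rightarrow> (nat set set \<Rightarrow> complex) \<Rightarrow>
   ('h::{real_inner,complete_space} \<Rightarrow> 'a) \<Rightarrow> bool" where
  "gaussian_process star \<epsilon> t G \<longleftrightarrow>
     t {{1, 2}} = 1 \<and>
     (\<forall>f. star (G f) = G f) \<and>
     (\<forall>n\<ge>1. \<forall>f :: nat \<Rightarrow> 'h.
        \<epsilon> (prod_list (map (\<lambda>i. G (f i)) [1..<2 * n + 1])) =
          (\<Sum>V\<in>pair_partitions {1..2 * n}.
             t V * (\<Prod>B\<in>V. complex_of_real (f (Min B) \<bullet> f (Max B))))) \<and>
     (\<forall>k. odd k \<longrightarrow> (\<forall>f :: nat \<Rightarrow> 'h.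
        \<epsilon> (prod_list (map (\<lambda>i. G (f i)) [1..<k + 1])) = 0))"

definition strong_gaussian_process ::
  "('a::ring_1 \<Rightarrow> 'a) \<Rightarrow> ('a \<Rightarrow> complex) \<Rightarrow> (nat set set \<Rightarrow> complex) \<Rightarrow>
   ('h::{real_inner,complete_space} \<Rightarrow> 'a) \<Rightarrow> bool" where
  "strong_gaussian_process star \<epsilon> t G \<longleftrightarrow>
     gaussian_process star \<epsilon> t G \<and> strongly_multiplicative t"

definition free_gaussian_process ::
  "('a::ring_1 \<Rightarrow> 'a) \<Rightarrow> ('a \<Rightarrow> complex) \<Rightarrow>
   ('h::{real_inner,complete_space} \<Rightarrow> 'a) \<Rightarrow> bool" where
  "free_gaussian_process star \<epsilon> G \<longleftrightarrow>
     gaussian_process star \<epsilon> (\<lambda>V. if noncrossing V then 1 else 0) G"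

end

theory Submission
  imports Defs
begin

text \<open>Expanding a moment of $X_b$ colours each position by $G$ or $G_0$. By freeness and strong
  multiplicativity, the mixed moment of a colouring is the sum of $t_G(V)$ times inner products over
  the pair partitions $V$ with monochromatic blocks whose $G_0$-coloured blocks are singletons.
  Exchanging the summations, each singleton of $V$ is coloured freely and contributes
  $b + (1 - b) = 1$, while each other block must be coloured by $G$ and contributes $b$; hence
  the factor $b^{H(V)}$.\<close>

section \<open>Pair partitions and their transport\<close>

text \<open>Freeness evaluates only alternating products of centred elements, so it does not yield
  the mixed moments directly. The way round is to give centring a combinatorial meaning: the
  partitions that separate an interval of positions contribute exactly the moment of the interval
  times the sum over the remaining positions, so subtracting the moment of a run amounts to
  discarding the partitions that separate it. Both sides then obey one recursion in the set of
  centred runs. Its correction terms delete a run, which leaves gaps among the positions and may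
  bring two runs of equal colour together. For this reason moments and weights are set up over
  arbitrary finite sets of positions with arbitrary colourings, and the induction runs over the
  position set.

  The condition on blocks coloured by \<open>G\<^sub>0\<close> merges two effects: freeness forbids
  crossings between the colours, and the free process forbids crossings among its own
  blocks.\<close>

lemma pair_partitionsD:
  assumes "V \<in> pair_partitions S"
  shows "\<Union>V = S" "disjoint V" "{} \<notin> V" "\<And>B. B \<in> V \<Longrightarrow> card B = 2"
    "\<And>B. B \<in> V \<Longrightarrow> finite B" "\<And>B. B \<in> V \<Longrightarrow> B \<noteq> {}" "\<And>B. B \<in> V \<Longrightarrow> B \<subseteq> S"
  using assms by (auto simp: pair_partitions_def partition_on_def card_ge_0_finite)

lemma pair_partitionsI:
  assumes "\<Union>V = S" "disjoint V" "\<And>B. B \<in> V \<Longrightarrow> card B = 2"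
  shows "V \<in> pair_partitions S"
proof -
  have "{} \<notin> V" using assms(3)[of "{}"] by auto
  then show ?thesis using assms by (simp add: pair_partitions_def partition_on_def)
qed

lemma pair_partitions_disjoint:
  assumes "V \<in> pair_partitions S" "B \<in> V" "C \<in> V" "x \<in> B" "x \<in> C"
  shows "B = C"
  using pair_partitionsD(2)[OF assms(1)] assms(2-) by (auto simp: disjoint_def)

lemma finite_pair_partition:
  assumes "finite S" "V \<in> pair_partitions S"
  shows "finite V"
  using finite_elements[OF assms(1)] assms(2) by (simp add: pair_partitions_def)

lemma finite_pair_partitions: "finite S \<Longrightarrow> finite (pair_partitions S)"
  by (rule finite_subset[OF _ finitely_many_partition_on]) (auto simp: pair_partitions_def)

lemma card_pair_partition:
  assumes "V \<in> pair_partitions S"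
  shows "card S = 2 * card V"
  using product_partition[of S V] pair_partitionsD[OF assms] assms
  by (simp add: pair_partitions_def)

lemma pair_partitions_empty [simp]: "pair_partitions {} = {{}}"
  by (auto simp: pair_partitions_def partition_on_empty)

lemma card_2_blockE:
  fixes B :: "'a::linorder set"
  assumes "card B = 2"
  obtains x y where "B = {x, y}" "x < y" "Min B = x" "Max B = y"
proof -
  obtain x y where "B = {x, y}" "x \<noteq> y" using assms by (auto simp: card_2_iff)
  then show ?thesis
    by (cases "x < y") (auto intro: that[of x y] that[of y x])
qed

section \<open>Crossings under order-preserving relabelling\<close>

lemma crosses_commute: "crosses B C \<longleftrightarrow> crosses C B"
  by (auto simp: crosses_def)

lemma not_crosses_self [simp]: "\<not> crosses B B"
  by (simp add: crosses_def)

lemma Min_Max_strict_mono_image: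
  fixes \<phi> :: "'a::linorder \<Rightarrow> 'b::linorder"
  assumes "strict_mono_on S \<phi>" "B \<subseteq> S" "finite B" "B \<noteq> {}"
  shows "Min (\<phi> ` B) = \<phi> (Min B)" "Max (\<phi> ` B) = \<phi> (Max B)"
proof -
  have le: "\<phi> x \<le> \<phi> y" if "x \<in> B" "y \<in> B" "x \<le> y" for x y
    using assms that strict_mono_on_leD[of S \<phi> x y] by blast
  show "Min (\<phi> ` B) = \<phi> (Min B)"
    using assms by (intro Min_eqI) (auto intro!: le Min_in)
  show "Max (\<phi> ` B) = \<phi> (Max B)"
    using assms by (intro Max_eqI) (auto intro!: le Max_in)
qed

lemma crosses_image:
  fixes \<phi> :: "'a::linorder \<Rightarrow> 'b::linorder"
  assumes "strict_mono_on S \<phi>" "B \<subseteq> S" "C \<subseteq> S" "finite B" "finite C" "B \<noteq> {}" "C \<noteq> {}"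
  shows "crosses (\<phi> ` B) (\<phi> ` C) \<longleftrightarrow> crosses B C"
proof -
  have *: "Min B \<in> S" "Max B \<in> S" "Min C \<in> S" "Max C \<in> S"
    using assms Min_in Max_in by blast+
  show ?thesis
    using assms * by (simp add: crosses_def Min_Max_strict_mono_image[of S] strict_mono_on_less)
qed

lemma pair_partitions_image:
  assumes "inj_on \<phi> S" "V \<in> pair_partitions S"
  shows "(`) \<phi> ` V \<in> pair_partitions (\<phi> ` S)"
proof -
  note V = pair_partitionsD[OF assms(2)]
  have "partition_on (\<phi> ` S) ((`) \<phi> ` V - {{}})"
    using assms by (intro partition_on_inj_image) (auto simp: pair_partitions_def)
  moreover have "(`) \<phi> ` V - {{}} = (`) \<phi> ` V" using V(3) by auto
  moreover have "card (\<phi> ` B) = 2" if "B \<in> V" for B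
    using V(4)[OF that] card_image[OF inj_on_subset[OF assms(1) V(7)[OF that]]] by simp
  ultimately show ?thesis by (auto simp: pair_partitions_def)
qed

lemma inj_on_image_blocks:
  assumes "inj_on \<phi> S" "V \<in> pair_partitions S"
  shows "inj_on ((`) \<phi>) V"
  by (rule inj_on_subset[OF inj_on_image_Pow[OF assms(1)]]) (use pair_partitionsD(7)[OF assms(2)] in auto)

lemma bij_betw_pair_partitions_image:
  assumes "inj_on \<phi> S"
  shows "bij_betw ((`) ((`) \<phi>)) (pair_partitions S) (pair_partitions (\<phi> ` S))"
proof (rule bij_betw_byWitness[where f' = "(`) ((`) (the_inv_into S \<phi>))"])
  let ?\<psi> = "the_inv_into S \<phi>"
  have inv: "?\<psi> ` \<phi> ` B = B" if "B \<subseteq> S" for B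
    using that the_inv_into_f_f[OF assms] by (force simp: image_iff)
  have inv': "\<phi> ` ?\<psi> ` B = B" if "B \<subseteq> \<phi> ` S" for B
    using that f_the_inv_into_f[OF assms] by (force simp: image_iff)
  show "\<forall>V\<in>pair_partitions S. (`) ?\<psi> ` (`) \<phi> ` V = V"
    using inv pair_partitionsD(7) by (force simp: image_iff)
  show "\<forall>V\<in>pair_partitions (\<phi> ` S). (`) \<phi> ` (`) ?\<psi> ` V = V"
    using inv' pair_partitionsD(7) by (force simp: image_iff)
  show "(`) ((`) \<phi>) ` pair_partitions S \<subseteq> pair_partitions (\<phi> ` S)"
    using pair_partitions_image[OF assms] by auto
  show "(`) ((`) ?\<psi>) ` pair_partitions (\<phi> ` S) \<subseteq> pair_partitions S"
    using pair_partitions_image[OF inj_on_the_inv_into[OF assms]] inv[of S] by auto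
qed

text \<open>Replaces the subtraction of natural numbers by the size of an explicit set of blocks,
  which can be followed through images and unions.\<close>

lemma nonsingleton_count_eq:
  assumes "finite V"
  shows "nonsingleton_count V = card {B \<in> V. \<exists>C\<in>V. crosses B C}"
proof -
  have "V = {B \<in> V. \<forall>C\<in>V. \<not> crosses B C} \<union> {B \<in> V. \<exists>C\<in>V. crosses B C}" by auto
  then have "card V = singleton_count V + card {B \<in> V. \<exists>C\<in>V. crosses B C}"
    unfolding singleton_count_def using assms by (subst card_Un_disjoint[symmetric]) auto
  then show ?thesis by (simp add: nonsingleton_count_def)
qed

lemma nonsingleton_count_image:
  fixes \<phi> :: "'a::linorder \<Rightarrow> 'b::linorder"
  assumes "strict_mono_on S \<phi>" "finite S" "V \<in> pair_partitions S"
  shows "nonsingleton_count ((`) \<phi> ` V) = nonsingleton_count V"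
proof -
  have inj: "inj_on ((`) \<phi>) V"
    using inj_on_image_blocks assms strict_mono_on_imp_inj_on by blast
  have fin: "finite V" using finite_pair_partition assms by blast
  have "crosses (\<phi> ` B) (\<phi> ` C) \<longleftrightarrow> crosses B C" if "B \<in> V" "C \<in> V" for B C
    using that by (intro crosses_image[OF assms(1)] pair_partitionsD(5-7)[OF assms(3)])
  then have "{B \<in> (`) \<phi> ` V. \<exists>C\<in>(`) \<phi> ` V. crosses B C} = (`) \<phi> ` {B \<in> V. \<exists>C\<in>V. crosses B C}"
    by auto
  then show ?thesis
    using fin inj by (simp add: nonsingleton_count_eq card_image inj_on_subset)
qed

text \<open>Ranks are invariant under strictly increasing maps. This permits moving between natural
  positions and the integer sets of \<open>strongly_multiplicative\<close>.\<close>

lemma standardize_image: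
  fixes \<phi> :: "'a::linorder \<Rightarrow> 'b::linorder"
  assumes "strict_mono_on S \<phi>" "V \<in> pair_partitions S"
  shows "standardize ((`) \<phi> ` V) = standardize V"
proof -
  have U: "\<Union>V = S" "\<Union>((`) \<phi> ` V) = \<phi> ` S" using pair_partitionsD(1)[OF assms(2)] by auto
  have *: "card {y \<in> \<phi> ` S. y \<le> \<phi> x} = card {y \<in> S. y \<le> x}" if "x \<in> S" for x
  proof -
    have "{y \<in> \<phi> ` S. y \<le> \<phi> x} = \<phi> ` {y \<in> S. y \<le> x}"
      using strict_mono_on_less_eq[OF assms(1)] that by auto
    moreover have "inj_on \<phi> {y \<in> S. y \<le> x}"
      by (rule inj_on_subset[OF strict_mono_on_imp_inj_on[OF assms(1)]]) auto
    ultimately show ?thesis by (simp add: card_image)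
  qed
  show ?thesis
    unfolding standardize_def U image_image
    using * pair_partitionsD(7)[OF assms(2)] by (intro image_cong refl) auto
qed

section \<open>Ranks and standardization\<close>

definition rank_in :: "'a::linorder set \<Rightarrow> 'a \<Rightarrow> nat" where
  "rank_in S x = card {y\<in>S. y \<le> x}"

lemma standardize_eq_rank_in_image:
  "V \<in> pair_partitions S \<Longrightarrow> standardize V = (`) (rank_in S) ` V"
  by (simp add: standardize_def rank_in_def[abs_def] pair_partitionsD(1))

lemma rank_in_props:
  assumes "finite S"
  shows "strict_mono_on S (rank_in S)" "bij_betw (rank_in S) S {1..card S}" "inj_on (rank_in S) S"
    "rank_in S ` S = {1..card S}"
  using rank_order_preserving_bij[OF assms, folded rank_in_def]
  by (auto simp: bij_betw_def)

lemma nonsingleton_count_standardize: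
  assumes "finite S" "V \<in> pair_partitions S"
  shows "nonsingleton_count (standardize V) = nonsingleton_count V"
  using nonsingleton_count_image[OF rank_in_props(1)] assms
  by (simp add: standardize_eq_rank_in_image)

lemma standardize_singleton:
  assumes "card B = 2"
  shows "standardize {B} = {{1, 2}}"
proof -
  obtain x y where B: "B = {x, y}" "x < y" using card_2_blockE[OF assms] by metis
  have "{z. (z = x \<or> z = y) \<and> z \<le> x} = {x}" "{z. (z = x \<or> z = y) \<and> z \<le> y} = {x, y}"
    using B(2) by auto
  then show ?thesis using B by (simp add: standardize_def numeral_2_eq_2)
qed

section \<open>Unions of mutually non-crossing pair partitions\<close>

lemma pair_partitions_Un:
  assumes "V\<^sub>1 \<in> pair_partitions S\<^sub>1" "V\<^sub>2 \<in> pair_partitions S\<^sub>2" "S\<^sub>1 \<inter> S\<^sub>2 = {}"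
  shows "V\<^sub>1 \<union> V\<^sub>2 \<in> pair_partitions (S\<^sub>1 \<union> S\<^sub>2)"
proof (rule pair_partitionsI)
  note 1 = pair_partitionsD[OF assms(1)] and 2 = pair_partitionsD[OF assms(2)]
  show "\<Union> (V\<^sub>1 \<union> V\<^sub>2) = S\<^sub>1 \<union> S\<^sub>2" using 1(1) 2(1) by auto
  show "disjoint (V\<^sub>1 \<union> V\<^sub>2)"
    using 1(1,2) 2(1,2) assms(3) by (intro disjoint_union) auto
  show "card B = 2" if "B \<in> V\<^sub>1 \<union> V\<^sub>2" for B using that 1(4) 2(4) by auto
qed

lemma pair_partitions_subset:
  assumes "V \<in> pair_partitions S" "W \<subseteq> V"
  shows "W \<in> pair_partitions (\<Union>W)"
  using assms pair_partitionsD[OF assms(1)]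
  by (intro pair_partitionsI) (auto intro: pairwise_subset)

lemma nonsingleton_count_Un:
  assumes "finite V\<^sub>1" "finite V\<^sub>2" "V\<^sub>1 \<inter> V\<^sub>2 = {}" "\<forall>B\<in>V\<^sub>1. \<forall>C\<in>V\<^sub>2. \<not> crosses B C"
  shows "nonsingleton_count (V\<^sub>1 \<union> V\<^sub>2) = nonsingleton_count V\<^sub>1 + nonsingleton_count V\<^sub>2"
proof -
  have "{B \<in> V\<^sub>1 \<union> V\<^sub>2. \<exists>C\<in>V\<^sub>1 \<union> V\<^sub>2. crosses B C} =
      {B \<in> V\<^sub>1. \<exists>C\<in>V\<^sub>1. crosses B C} \<union> {B \<in> V\<^sub>2. \<exists>C\<in>V\<^sub>2. crosses B C}"
    using assms(4) crosses_commute by blast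
  then show ?thesis
    using assms by (simp add: nonsingleton_count_eq card_Un_disjoint disjoint_iff)
qed

text \<open>The number of crossing blocks is additive over unions without mutual crossings and
  unchanged by standardization, so its powers multiply for every base, including 0 with
  \<open>0 ^ 0 = 1\<close>.\<close>

lemma strongly_multiplicative_nonsingleton_count:
  assumes "strongly_multiplicative t"
  shows "strongly_multiplicative (\<lambda>V. z ^ nonsingleton_count V * t V)"
  unfolding strongly_multiplicative_def
proof (intro allI impI)
  fix S\<^sub>1 S\<^sub>2 :: "int set" and V\<^sub>1 V\<^sub>2
  assume *: "finite S\<^sub>1" "finite S\<^sub>2" "S\<^sub>1 \<noteq> {}" "S\<^sub>2 \<noteq> {}" "S\<^sub>1 \<inter> S\<^sub>2 = {}"
    "V\<^sub>1 \<in> pair_partitions S\<^sub>1" "V\<^sub>2 \<in> pair_partitions S\<^sub>2" "\<forall>B\<in>V\<^sub>1. \<forall>C\<in>V\<^sub>2. \<not> crosses B C"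
  have "V\<^sub>1 \<inter> V\<^sub>2 = {}"
    using pair_partitionsD(6,7)[OF *(6)] pair_partitionsD(7)[OF *(7)] *(5) by fast
  then have "nonsingleton_count (V\<^sub>1 \<union> V\<^sub>2) = nonsingleton_count V\<^sub>1 + nonsingleton_count V\<^sub>2"
    using finite_pair_partition[OF *(1,6)] finite_pair_partition[OF *(2,7)] *(8)
    by (intro nonsingleton_count_Un)
  moreover have "V\<^sub>1 \<union> V\<^sub>2 \<in> pair_partitions (S\<^sub>1 \<union> S\<^sub>2)" using * pair_partitions_Un by blast
  moreover have "t (standardize (V\<^sub>1 \<union> V\<^sub>2)) = t (standardize V\<^sub>1) * t (standardize V\<^sub>2)"
    using assms * unfolding strongly_multiplicative_def by blast
  ultimately show "z ^ nonsingleton_count (standardize (V\<^sub>1 \<union> V\<^sub>2)) * t (standardize (V\<^sub>1 \<union> V\<^sub>2)) =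
      z ^ nonsingleton_count (standardize V\<^sub>1) * t (standardize V\<^sub>1) *
      (z ^ nonsingleton_count (standardize V\<^sub>2) * t (standardize V\<^sub>2))"
    using * nonsingleton_count_standardize[of S\<^sub>1] nonsingleton_count_standardize[of S\<^sub>2]
      nonsingleton_count_standardize[of "S\<^sub>1 \<union> S\<^sub>2"]
    by (simp add: power_add)
qed

section \<open>Weights of pair partitions of arbitrary position sets\<close>

text \<open>The value of $t$ at the empty partition is arbitrary; the weight is normalized there.\<close>

definition weight :: "(nat set set \<Rightarrow> complex) \<Rightarrow> nat set set \<Rightarrow> complex" where
  "weight t V = (if V = {} then 1 else t (standardize V))"

text \<open>Positions here are natural numbers, while strong multiplicativity is phrased for
  integers; the embedding \<open>int\<close> preserves crossings and standardizations. An empty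
  factor is covered by the normalization of \<open>weight\<close>.\<close>

lemma weight_Un:
  assumes "strongly_multiplicative t" "finite S\<^sub>1" "finite S\<^sub>2" "S\<^sub>1 \<inter> S\<^sub>2 = {}"
    "V\<^sub>1 \<in> pair_partitions S\<^sub>1" "V\<^sub>2 \<in> pair_partitions S\<^sub>2"
    "\<forall>B\<in>V\<^sub>1. \<forall>C\<in>V\<^sub>2. \<not> crosses B C"
  shows "weight t (V\<^sub>1 \<union> V\<^sub>2) = weight t V\<^sub>1 * weight t V\<^sub>2"
proof (cases "V\<^sub>1 = {} \<or> V\<^sub>2 = {}")
  case True
  then show ?thesis by (auto simp: weight_def)
next
  case False
  let ?i = "(`) ((`) int)"
  have mono: "strict_mono_on S int" for S by (simp add: strict_mono_on_def)
  then have inj: "inj_on int S" for S by simp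
  have V: "V\<^sub>1 \<union> V\<^sub>2 \<in> pair_partitions (S\<^sub>1 \<union> S\<^sub>2)"
    using pair_partitions_Un assms by blast
  have ne: "S\<^sub>1 \<noteq> {}" "S\<^sub>2 \<noteq> {}" using False assms(5,6) by auto
  have cr: "\<forall>B\<in>?i V\<^sub>1. \<forall>C\<in>?i V\<^sub>2. \<not> crosses B C"
  proof (intro ballI)
    fix B C assume "B \<in> ?i V\<^sub>1" "C \<in> ?i V\<^sub>2"
    then obtain B' C' where "B = int ` B'" "C = int ` C'" "B' \<in> V\<^sub>1" "C' \<in> V\<^sub>2" by auto
    then show "\<not> crosses B C"
      using crosses_image[OF mono[of UNIV], of B' C'] assms(7) pair_partitionsD[OF assms(5)]
        pair_partitionsD[OF assms(6)] by auto
  qed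
  have "t (standardize (?i V\<^sub>1 \<union> ?i V\<^sub>2)) = t (standardize (?i V\<^sub>1)) * t (standardize (?i V\<^sub>2))"
    using assms(1)[unfolded strongly_multiplicative_def, rule_format,
        of "int ` S\<^sub>1" "int ` S\<^sub>2" "?i V\<^sub>1" "?i V\<^sub>2"]
      pair_partitions_image[OF inj assms(5)] pair_partitions_image[OF inj assms(6)] cr ne assms(2-4)
    by (simp flip: image_Int)
  then show ?thesis
    using False standardize_image[OF mono V] standardize_image[OF mono assms(5)]
      standardize_image[OF mono assms(6)]
    by (simp add: weight_def image_Un)
qed

text \<open>Blocks can be split off one at a time, and each single block standardizes to
  \<open>{{1, 2}}\<close>. Hence on non-crossing partitions \<open>t\<close> agrees with the weight
  of the free process and may replace it.\<close>

lemma weight_noncrossing: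
  assumes "strongly_multiplicative t" "t {{1, 2}} = 1"
    and "finite S" "V \<in> pair_partitions S" "noncrossing V"
  shows "weight t V = 1"
proof -
  have "finite V" using finite_pair_partition assms by blast
  moreover have "weight t W = 1" if "finite W" "W \<subseteq> V" for W
    using that
  proof (induction W rule: finite_induct)
    case empty
    then show ?case by (simp add: weight_def)
  next
    case (insert B W)
    have W: "W \<in> pair_partitions (\<Union>W)" and B: "{B} \<in> pair_partitions (\<Union>{B})"
      by (rule pair_partitions_subset[OF assms(4)]; use insert.prems in simp)+
    have "weight t ({B} \<union> W) = weight t {B} * weight t W"
    proof (rule weight_Un[OF assms(1) _ _ _ B W])
      show "finite (\<Union>{B})" "finite (\<Union>W)"
        using insert.prems insert.hyps pair_partitionsD(5)[OF assms(4)] by auto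
      show "\<Union>{B} \<inter> \<Union>W = {}"
        using insert.prems insert.hyps(2) pair_partitions_disjoint[OF assms(4)] by blast
      show "\<forall>B\<in>{B}. \<forall>C\<in>W. \<not> crosses B C"
        using assms(5) insert.prems by (auto simp: noncrossing_def)
    qed
    moreover have "weight t {B} = 1"
      using insert.prems pair_partitionsD(4)[OF assms(4), of B] assms(2)
      by (simp add: weight_def standardize_singleton)
    ultimately show ?case using insert by simp
  qed
  ultimately show ?thesis by blast
qed

definition pairing :: "(nat \<Rightarrow> 'h::real_inner) \<Rightarrow> nat set set \<Rightarrow> complex" where
  "pairing f V = (\<Prod>B\<in>V. complex_of_real (f (Min B) \<bullet> f (Max B)))"

section \<open>Moments over arbitrary finite sets of positions\<close>

lemma sorted_list_of_set_image:
  fixes \<phi> :: "'a::linorder \<Rightarrow> 'b::linorder"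
  assumes "finite S" "strict_mono_on S \<phi>"
  shows "sorted_list_of_set (\<phi> ` S) = map \<phi> (sorted_list_of_set S)"
proof (rule sorted_distinct_set_unique)
  have inj: "inj_on \<phi> S" using assms(2) by (rule strict_mono_on_imp_inj_on)
  show "distinct (map \<phi> (sorted_list_of_set S))" using inj assms(1) by (simp add: distinct_map)
  show "sorted (map \<phi> (sorted_list_of_set S))"
    unfolding sorted_map using assms strict_mono_on_leD[OF assms(2)]
    by (intro sorted_wrt_mono_rel[OF _ sorted_sorted_list_of_set]) auto
qed (use assms in auto)

text \<open>Relabelling positions by rank turns the word into one over an initial segment, where the
  defining moment formula applies; \<open>g\<close> carries the vector of each position to its
  rank.\<close>

lemma gaussian_process_moment:
  fixes G :: "'h::{real_inner,complete_space} \<Rightarrow> 'a::ring_1" and f :: "nat \<Rightarrow> 'h"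
  assumes "gaussian_process star \<epsilon> t G" "\<epsilon> 1 = 1" "finite S"
  shows "\<epsilon> (prod_list (map (\<lambda>i. G (f i)) (sorted_list_of_set S))) =
    (\<Sum>V\<in>pair_partitions S. weight t V * pairing f V)"
proof -
  define g where "g = f \<circ> the_inv_into S (rank_in S)"
  note r = rank_in_props[OF assms(3)]
  have g: "g (rank_in S x) = f x" if "x \<in> S" for x
    using that the_inv_into_f_f[OF r(3)] by (simp add: g_def)
  have "map (rank_in S) (sorted_list_of_set S) = [1..<card S + 1]"
    using sorted_list_of_set_image[OF assms(3) r(1)] r(4)
    by (simp add: atLeastLessThanSuc_atLeastAtMost[symmetric])
  then have "map (\<lambda>i. G (g i)) [1..<card S + 1] = map (\<lambda>i. G (g i)) (map (rank_in S) (sorted_list_of_set S))"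
    by simp
  also have "\<dots> = map (\<lambda>i. G (f i)) (sorted_list_of_set S)"
    using g assms(3) by simp
  finally have lhs: "map (\<lambda>i. G (f i)) (sorted_list_of_set S) = map (\<lambda>i. G (g i)) [1..<card S + 1]"
    by simp
  \<comment> \<open>The definition of the process covers positive even and odd lengths; the empty
    word is settled by \<open>\<epsilon> 1 = 1\<close>, matched by the normalized weight of the
    empty partition.\<close>
  consider "S = {}" | "odd (card S)" | n where "card S = 2 * n" "n \<ge> 1"
    using assms(3) by (metis One_nat_def Suc_leI card_eq_0_iff evenE gr0I mult_0_right)
  then show ?thesis
  proof cases
    case 1
    then show ?thesis using assms(2) by (simp add: weight_def pairing_def)
  next
    case 2
    then have "pair_partitions S = {}" using card_pair_partition by fastforce
    moreover have "\<epsilon> (prod_list (map (\<lambda>i. G (g i)) [1..<card S + 1])) = 0"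
      using assms(1) 2 unfolding gaussian_process_def by blast
    ultimately show ?thesis using lhs by simp
  next
    case 3
    have "\<epsilon> (prod_list (map (\<lambda>i. G (g i)) [1..<card S + 1])) =
        (\<Sum>V\<in>pair_partitions {1..card S}. t V * pairing g V)"
      using assms(1) 3 unfolding gaussian_process_def pairing_def by simp
    also have "\<dots> = (\<Sum>V\<in>pair_partitions S. t ((`) (rank_in S) ` V) * pairing g ((`) (rank_in S) ` V))"
      using bij_betw_pair_partitions_image[OF r(3)] r(4)
      by (subst sum.reindex_bij_betw[symmetric]) auto
    also have "\<dots> = (\<Sum>V\<in>pair_partitions S. weight t V * pairing f V)"
    proof (rule sum.cong[OF refl])
      fix V assume V: "V \<in> pair_partitions S"
      have "V \<noteq> {}" using V 3 card_pair_partition by fastforce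
      then have "t ((`) (rank_in S) ` V) = weight t V"
        using standardize_eq_rank_in_image[OF V] by (simp add: weight_def)
      moreover have "pairing g ((`) (rank_in S) ` V) = pairing f V"
        unfolding pairing_def
      proof (subst prod.reindex[OF inj_on_image_blocks[OF r(3) V]], rule prod.cong[OF refl])
        fix B assume B: "B \<in> V"
        have B': "B \<subseteq> S" "finite B" "B \<noteq> {}" using pair_partitionsD[OF V] B by simp_all
        then have "Min B \<in> S" "Max B \<in> S" using Min_in Max_in by blast+
        then show "((\<lambda>B. complex_of_real (g (Min B) \<bullet> g (Max B))) \<circ> (`) (rank_in S)) B =
            complex_of_real (f (Min B) \<bullet> f (Max B))"
          using Min_Max_strict_mono_image[OF r(1) B'] g by simp
      qed
      ultimately show "t ((`) (rank_in S) ` V) * pairing g ((`) (rank_in S) ` V) = weight t V * pairing f V"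
        by simp
    qed
    finally show ?thesis using lhs by simp
  qed
qed

section \<open>Coloured pair partitions\<close>

text \<open>For \<open>I\<close> inside the ground set of \<open>V\<close>, this says that
  \<open>I\<close> is a union of blocks, so that \<open>V\<close> splits into a pair partition of
  \<open>I\<close> and one of the complement.\<close>

definition separates :: "'a set \<Rightarrow> 'a set set \<Rightarrow> bool" where
  "separates I V \<longleftrightarrow> (\<forall>B\<in>V. B \<subseteq> I \<or> B \<inter> I = {})"

text \<open>The set $A$ collects the positions carrying $G$; the others carry $G_0$, whose blocks must be
  singletons. Singletons have weight $1$, so the product of the weights of the two colours is
  the weight of the whole partition.\<close>

definition admissible :: "nat set \<Rightarrow> nat set set \<Rightarrow> bool" where
  "admissible A V \<longleftrightarrow> (\<forall>B\<in>V. B \<subseteq> A \<or> B \<inter> A = {} \<and> (\<forall>C\<in>V. \<not> crosses B C))"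

text \<open>The family of sets lists the centred runs: forbidding \<open>V\<close> to separate a run
  is the counterpart of subtracting the moment of that run. With the empty family this is the full
  mixed moment.\<close>

definition mixed_sum ::
  "(nat set set \<Rightarrow> complex) \<Rightarrow> (nat \<Rightarrow> 'h::real_inner) \<Rightarrow> nat set \<Rightarrow> nat set set \<Rightarrow> nat set \<Rightarrow> complex" where
  "mixed_sum t f A \<C> S =
    (\<Sum>V\<in>{V \<in> pair_partitions S. admissible A V \<and> (\<forall>I\<in>\<C>. \<not> separates I V)}. weight t V * pairing f V)"

section \<open>Splitting along an interval of positions\<close>

lemma bij_betw_Un_separates:
  assumes "I \<subseteq> S"
  shows "bij_betw (\<lambda>(V\<^sub>1, V\<^sub>2). V\<^sub>1 \<union> V\<^sub>2) (pair_partitions I \<times> pair_partitions (S - I))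
    {V \<in> pair_partitions S. separates I V}"
proof (rule bij_betw_byWitness[where f' = "\<lambda>V. ({B \<in> V. B \<subseteq> I}, {B \<in> V. B \<inter> I = {}})"])
  \<comment> \<open>Blocks are non-empty, so lying inside \<open>I\<close> and missing
    \<open>I\<close> exclude each other and the two parts can be recovered from their union.\<close>
  have *: "{B \<in> V\<^sub>1 \<union> V\<^sub>2. B \<subseteq> I} = V\<^sub>1" "{B \<in> V\<^sub>1 \<union> V\<^sub>2. B \<inter> I = {}} = V\<^sub>2"
    if "V\<^sub>1 \<in> pair_partitions I" "V\<^sub>2 \<in> pair_partitions (S - I)" for V\<^sub>1 V\<^sub>2
  proof -
    have "B \<subseteq> I \<and> B \<inter> I \<noteq> {}" if "B \<in> V\<^sub>1" for B
      using that pair_partitionsD(6,7)[OF \<open>V\<^sub>1 \<in> pair_partitions I\<close> that] by auto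
    moreover have "\<not> B \<subseteq> I \<and> B \<inter> I = {}" if "B \<in> V\<^sub>2" for B
      using that pair_partitionsD(6,7)[OF \<open>V\<^sub>2 \<in> pair_partitions (S - I)\<close> that] by auto
    ultimately show "{B \<in> V\<^sub>1 \<union> V\<^sub>2. B \<subseteq> I} = V\<^sub>1" "{B \<in> V\<^sub>1 \<union> V\<^sub>2. B \<inter> I = {}} = V\<^sub>2"
      by auto
  qed
  then show "\<forall>x\<in>pair_partitions I \<times> pair_partitions (S - I).
      (\<lambda>V. ({B \<in> V. B \<subseteq> I}, {B \<in> V. B \<inter> I = {}})) (case x of (V\<^sub>1, V\<^sub>2) \<Rightarrow> V\<^sub>1 \<union> V\<^sub>2) = x"
    by (auto simp: split_beta)
  show "\<forall>V\<in>{V \<in> pair_partitions S. separates I V}.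
      (case ({B \<in> V. B \<subseteq> I}, {B \<in> V. B \<inter> I = {}}) of (V\<^sub>1, V\<^sub>2) \<Rightarrow> V\<^sub>1 \<union> V\<^sub>2) = V"
    by (auto simp: separates_def)
  show "(\<lambda>(V\<^sub>1, V\<^sub>2). V\<^sub>1 \<union> V\<^sub>2) ` (pair_partitions I \<times> pair_partitions (S - I))
      \<subseteq> {V \<in> pair_partitions S. separates I V}"
  proof clarsimp
    fix V\<^sub>1 V\<^sub>2 assume V: "V\<^sub>1 \<in> pair_partitions I" "V\<^sub>2 \<in> pair_partitions (S - I)"
    have "I \<union> (S - I) = S" using assms by auto
    then have "V\<^sub>1 \<union> V\<^sub>2 \<in> pair_partitions S"
      using pair_partitions_Un[OF V] by auto
    moreover have "separates I (V\<^sub>1 \<union> V\<^sub>2)"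
      using pair_partitionsD(7)[OF V(1)] pair_partitionsD(7)[OF V(2)]
      unfolding separates_def by blast
    ultimately show "V\<^sub>1 \<union> V\<^sub>2 \<in> pair_partitions S \<and> separates I (V\<^sub>1 \<union> V\<^sub>2)" by blast
  qed
  show "(\<lambda>V. ({B \<in> V. B \<subseteq> I}, {B \<in> V. B \<inter> I = {}})) ` {V \<in> pair_partitions S. separates I V}
      \<subseteq> pair_partitions I \<times> pair_partitions (S - I)"
  proof clarsimp
    fix V assume V: "V \<in> pair_partitions S" "separates I V"
    have "\<Union>{B \<in> V. B \<subseteq> I} = I" "\<Union>{B \<in> V. B \<inter> I = {}} = S - I"
    proof -
      have *: "\<exists>B\<in>V. x \<in> B" if "x \<in> S" for x
        using that pair_partitionsD(1)[OF V(1)] by (metis Union_iff)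
      have sep: "B \<subseteq> I \<or> B \<inter> I = {}" if "B \<in> V" for B
        using V(2) that by (simp add: separates_def)
      show "\<Union>{B \<in> V. B \<subseteq> I} = I"
      proof (intro equalityI subsetI)
        fix x assume "x \<in> I"
        then obtain B where "B \<in> V" "x \<in> B" using * assms by auto
        then show "x \<in> \<Union>{B \<in> V. B \<subseteq> I}" using sep[of B] \<open>x \<in> I\<close> by auto
      qed auto
      show "\<Union>{B \<in> V. B \<inter> I = {}} = S - I"
      proof (intro equalityI subsetI)
        fix x assume "x \<in> S - I"
        then obtain B where "B \<in> V" "x \<in> B" using * by auto
        then show "x \<in> \<Union>{B \<in> V. B \<inter> I = {}}" using sep[of B] \<open>x \<in> S - I\<close> by auto
      next
        fix x assume "x \<in> \<Union>{B \<in> V. B \<inter> I = {}}"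
        then obtain B where "B \<in> V" "x \<in> B" "B \<inter> I = {}" by auto
        then show "x \<in> S - I" using pair_partitionsD(7)[OF V(1)] by auto
      qed
    qed
    then show "{B \<in> V. B \<subseteq> I} \<in> pair_partitions I \<and>
        {B \<in> V. B \<inter> I = {}} \<in> pair_partitions (S - I)"
      using pair_partitions_subset[OF V(1), of "{B \<in> V. B \<subseteq> I}"]
        pair_partitions_subset[OF V(1), of "{B \<in> V. B \<inter> I = {}}"] by auto
  qed
qed

text \<open>A crossing puts an endpoint of \<open>C\<close> strictly between the endpoints of
  \<open>B\<close>; convexity would force that endpoint into \<open>I\<close>.\<close>

lemma not_crosses_convex:
  assumes "card B = 2" "card C = 2" "B \<subseteq> I" "C \<subseteq> S - I"
    and "\<And>x y z. \<lbrakk>x \<in> I; z \<in> I; y \<in> S; x < y; y < z\<rbrakk> \<Longrightarrow> y \<in> I"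
  shows "\<not> crosses B C"
proof -
  obtain x y where B: "B = {x, y}" "x < y" "Min B = x" "Max B = y" using assms(1) by (rule card_2_blockE)
  obtain z w where C: "C = {z, w}" "z < w" "Min C = z" "Max C = w" using assms(2) by (rule card_2_blockE)
  have "\<not> (x < z \<and> z < y)" "\<not> (x < w \<and> w < y)"
    using assms(3,4) assms(5)[of x y] B C by auto
  then show ?thesis using B C by (auto simp: crosses_def)
qed

text \<open>The combinatorial form of centring \<open>I\<close>. Partitions that do not separate
  \<open>I\<close> give the first term. The others are unions of a partition of the interval
  \<open>I\<close> and one of the rest, which do not cross, so weights and inner products
  factor.\<close>

lemma mixed_sum_split:
  assumes t: "strongly_multiplicative t" and S: "finite S" and I: "I \<subseteq> S"
    and convex: "\<And>x y z. \<lbrakk>x \<in> I; z \<in> I; y \<in> S; x < y; y < z\<rbrakk> \<Longrightarrow> y \<in> I"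
    and disj: "\<And>J. J \<in> \<C> \<Longrightarrow> J \<inter> I = {}"
  shows "mixed_sum t f A \<C> S =
    mixed_sum t f A (insert I \<C>) S + mixed_sum t f A {} I * mixed_sum t f A \<C> (S - I)"
proof -
  define P where "P V \<longleftrightarrow> admissible A V \<and> (\<forall>J\<in>\<C>. \<not> separates J V)" for V
  let ?w = "\<lambda>V. weight t V * pairing f V"
  let ?X = "pair_partitions I \<times> pair_partitions (S - I)"
  have Un: "P (V\<^sub>1 \<union> V\<^sub>2) \<longleftrightarrow> admissible A V\<^sub>1 \<and> P V\<^sub>2" "?w (V\<^sub>1 \<union> V\<^sub>2) = ?w V\<^sub>1 * ?w V\<^sub>2"
    if V: "V\<^sub>1 \<in> pair_partitions I" "V\<^sub>2 \<in> pair_partitions (S - I)" for V\<^sub>1 V\<^sub>2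
  proof -
    have sub: "\<And>B. B \<in> V\<^sub>1 \<Longrightarrow> B \<subseteq> I" "\<And>B. B \<in> V\<^sub>2 \<Longrightarrow> B \<subseteq> S - I"
      using pair_partitionsD(7)[OF V(1)] pair_partitionsD(7)[OF V(2)] by auto
    have nc: "\<not> crosses B C" if "B \<in> V\<^sub>1" "C \<in> V\<^sub>2" for B C
      by (rule not_crosses_convex[OF pair_partitionsD(4)[OF V(1) that(1)]
            pair_partitionsD(4)[OF V(2) that(2)] sub(1)[OF that(1)] sub(2)[OF that(2)]])
        (erule (4) convex)
    then have nc': "\<not> crosses C B" if "B \<in> V\<^sub>1" "C \<in> V\<^sub>2" for B C
      using that crosses_commute by blast
    have "admissible A (V\<^sub>1 \<union> V\<^sub>2) \<longleftrightarrow> admissible A V\<^sub>1 \<and> admissible A V\<^sub>2"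
      by (auto simp: admissible_def ball_Un nc nc')
    \<comment> \<open>Blocks inside \<open>I\<close> miss \<open>J\<close>, so whether
      \<open>J\<close> is separated depends on the outer part alone, and the constraints pass
      entirely to the second factor.\<close>
    moreover have "separates J (V\<^sub>1 \<union> V\<^sub>2) \<longleftrightarrow> separates J V\<^sub>2" if "J \<in> \<C>" for J
    proof -
      have "separates J V\<^sub>1" using disj[OF that] sub(1) by (fastforce simp: separates_def)
      then show ?thesis by (simp add: separates_def ball_Un)
    qed
    ultimately show "P (V\<^sub>1 \<union> V\<^sub>2) \<longleftrightarrow> admissible A V\<^sub>1 \<and> P V\<^sub>2" by (auto simp: P_def)
    have fin: "finite I" "finite (S - I)" using S I finite_subset by auto
    have "weight t (V\<^sub>1 \<union> V\<^sub>2) = weight t V\<^sub>1 * weight t V\<^sub>2"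
      using nc by (intro weight_Un[OF t fin _ V]) auto
    moreover have "V\<^sub>1 \<inter> V\<^sub>2 = {}"
      using sub pair_partitionsD(6)[OF V(1)] by fast
    then have "pairing f (V\<^sub>1 \<union> V\<^sub>2) = pairing f V\<^sub>1 * pairing f V\<^sub>2"
      unfolding pairing_def
      using finite_pair_partition[OF fin(1) V(1)] finite_pair_partition[OF fin(2) V(2)]
      by (intro prod.union_disjoint)
    ultimately show "?w (V\<^sub>1 \<union> V\<^sub>2) = ?w V\<^sub>1 * ?w V\<^sub>2" by simp
  qed
  have "bij_betw (\<lambda>(V\<^sub>1, V\<^sub>2). V\<^sub>1 \<union> V\<^sub>2) {x \<in> ?X. admissible A (fst x) \<and> P (snd x)}
      {V \<in> {V \<in> pair_partitions S. separates I V}. P V}"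
    by (rule bij_betw_Collect[OF bij_betw_Un_separates[OF I]]) (auto simp: Un)
  moreover have "{x \<in> ?X. admissible A (fst x) \<and> P (snd x)} =
      {V \<in> pair_partitions I. admissible A V} \<times> {V \<in> pair_partitions (S - I). P V}" by auto
  ultimately have bij: "bij_betw (\<lambda>(V\<^sub>1, V\<^sub>2). V\<^sub>1 \<union> V\<^sub>2)
      ({V \<in> pair_partitions I. admissible A V} \<times> {V \<in> pair_partitions (S - I). P V})
      {V \<in> {V \<in> pair_partitions S. separates I V}. P V}" by simp
  have "mixed_sum t f A \<C> S = sum ?w {V \<in> pair_partitions S. P V}"
    by (simp add: mixed_sum_def P_def)
  also have "{V \<in> pair_partitions S. P V} = {V \<in> pair_partitions S. P V \<and> \<not> separates I V} \<union>
      {V \<in> {V \<in> pair_partitions S. separates I V}. P V}" by auto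
  also have "sum ?w \<dots> = sum ?w {V \<in> pair_partitions S. P V \<and> \<not> separates I V} +
      sum ?w {V \<in> {V \<in> pair_partitions S. separates I V}. P V}"
    using finite_pair_partitions[OF S] by (intro sum.union_disjoint) auto
  also have "sum ?w {V \<in> pair_partitions S. P V \<and> \<not> separates I V} = mixed_sum t f A (insert I \<C>) S"
    unfolding mixed_sum_def P_def by (rule sum.cong) auto
  also have "sum ?w {V \<in> {V \<in> pair_partitions S. separates I V}. P V} =
      (\<Sum>(V\<^sub>1, V\<^sub>2)\<in>{V \<in> pair_partitions I. admissible A V} \<times> {V \<in> pair_partitions (S - I). P V}.
        ?w V\<^sub>1 * ?w V\<^sub>2)"
    unfolding sum.reindex_bij_betw[OF bij, symmetric] by (intro sum.cong refl) (auto simp: Un)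
  also have "\<dots> = mixed_sum t f A {} I * mixed_sum t f A \<C> (S - I)"
    by (simp add: mixed_sum_def P_def sum_product sum.cartesian_product)
  finally show ?thesis .
qed

text \<open>Here \<open>\<rho>\<close> sends a position to the index of its run and \<open>c\<close>
  gives the colour of a run. Monotonicity makes runs consecutive, and the image condition makes
  every run non-empty. In the induction the new largest position either joins the last run or opens
  another.\<close>

lemma monochromatic_runs:
  fixes S A :: "nat set"
  assumes "finite S"
  obtains n :: nat and \<rho> :: "nat \<Rightarrow> nat" and c :: "nat \<Rightarrow> bool"
  where "\<rho> ` S = {..<n}" "mono_on S \<rho>" "\<And>x. x \<in> S \<Longrightarrow> c (\<rho> x) \<longleftrightarrow> x \<in> A"
    "\<And>k. Suc k < n \<Longrightarrow> c k \<noteq> c (Suc k)"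
proof -
  have "\<exists>n \<rho> c. \<rho> ` S = {..<n} \<and> mono_on S \<rho> \<and> (\<forall>x\<in>S. c (\<rho> x) \<longleftrightarrow> x \<in> A) \<and>
      (\<forall>k. Suc k < n \<longrightarrow> c k \<noteq> c (Suc k))" (is "\<exists>n \<rho> c. ?Q S n \<rho> c")
    using assms
  proof (induction S rule: finite_linorder_max_induct)
    case empty
    show ?case by (rule exI[of _ 0]) simp
  next
    case (insert m S)
    from insert.IH obtain n \<rho> c where "?Q S n \<rho> c" by (elim exE) (rule that)
    then have IH: "\<rho> ` S = {..<n}" "mono_on S \<rho>" "\<forall>x\<in>S. c (\<rho> x) \<longleftrightarrow> x \<in> A"
      "\<forall>k. Suc k < n \<longrightarrow> c k \<noteq> c (Suc k)" by simp_all
    have m: "m \<notin> S" using insert.hyps by auto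
    have less: "\<rho> x < n" if "x \<in> S" for x using IH(1) that by auto
    show ?case
    \<comment> \<open>For \<open>n = 0\<close> there is no last run, and \<open>c (n - 1)\<close>
      would read a meaningless colour at index 0.\<close>
    proof (cases "n \<noteq> 0 \<and> (c (n - 1) \<longleftrightarrow> m \<in> A)")
      case True
      let ?\<rho> = "\<rho>(m := n - 1)"
      have "?\<rho> ` S = \<rho> ` S" using m by (intro image_cong) auto
      then have "?\<rho> ` insert m S = {..<n}" using True IH(1) by (auto simp only: image_insert fun_upd_same insert_absorb lessThan_iff)
      moreover have "mono_on (insert m S) ?\<rho>"
        using IH(2) insert.hyps m less by (fastforce simp: monotone_on_def)
      moreover have "\<forall>x\<in>insert m S. c (?\<rho> x) \<longleftrightarrow> x \<in> A" using IH(3) True by auto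
      ultimately have "?Q (insert m S) n ?\<rho> c" using IH(4) by (intro conjI)
      then show ?thesis by (intro exI)
    next
      case False
      let ?\<rho> = "\<rho>(m := n)" and ?c = "c(n := m \<in> A)"
      have "?\<rho> ` S = \<rho> ` S" using m by (intro image_cong) auto
      then have "?\<rho> ` insert m S = {..<Suc n}" using IH(1) by (simp only: image_insert fun_upd_same lessThan_Suc)
      moreover have "mono_on (insert m S) ?\<rho>"
        using IH(2) insert.hyps m less by (fastforce simp: monotone_on_def)
      moreover have "\<forall>x\<in>insert m S. ?c (?\<rho> x) \<longleftrightarrow> x \<in> A"
        using IH(3) less by auto
      moreover have "\<forall>k. Suc k < Suc n \<longrightarrow> ?c k \<noteq> ?c (Suc k)"
      proof (intro allI impI)
        fix k assume "Suc k < Suc n"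
        then show "?c k \<noteq> ?c (Suc k)"
          using IH(4)[rule_format, of k] False by (cases "Suc k = n") auto
      qed
      ultimately have "?Q (insert m S) (Suc n) ?\<rho> ?c" by (intro conjI)
      then show ?thesis by (intro exI)
    qed
  qed
  then show ?thesis
  proof (elim exE)
    fix n \<rho> c assume "?Q S n \<rho> c"
    then show ?thesis by (intro that[of \<rho> n c]) auto
  qed
qed

text \<open>Descent on the distance of two paired positions in different runs: the run following the
  left one has the other colour, so a block leaving that run cannot cross the given block and
  therefore stays inside it.\<close>

lemma admissible_separates_run:
  fixes S :: "nat set"
  assumes V: "V \<in> pair_partitions S" "admissible A V" and n: "n \<ge> 1"
    and \<rho>: "\<rho> ` S = {..<n}" "mono_on S \<rho>"
    and c: "\<And>x. x \<in> S \<Longrightarrow> c (\<rho> x) \<longleftrightarrow> x \<in> A" "\<And>k. Suc k < n \<Longrightarrow> c k \<noteq> c (Suc k)"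
  shows "\<exists>k<n. separates {x \<in> S. \<rho> x = k} V"
proof (rule ccontr)
  assume "\<not> ?thesis"
  then have "\<not> separates {x \<in> S. \<rho> x = k} V" if "k < n" for k using that by simp
  then have nsep: "\<exists>B\<in>V. \<not> B \<subseteq> {x \<in> S. \<rho> x = k} \<and> B \<inter> {x \<in> S. \<rho> x = k} \<noteq> {}" if "k < n" for k
    using that unfolding separates_def by blast
  have leave: "\<exists>p q. {p, q} \<in> V \<and> p \<in> S \<and> q \<in> S \<and> \<rho> p = k \<and> \<rho> q \<noteq> k" if k: "k < n" for k
  proof -
    obtain B where B: "B \<in> V" "\<not> B \<subseteq> {x \<in> S. \<rho> x = k}" "B \<inter> {x \<in> S. \<rho> x = k} \<noteq> {}"
      using nsep[OF k] by blast
    obtain x y where xy: "B = {x, y}" using pair_partitionsD(4)[OF V(1) B(1)] by (auto simp: card_2_iff)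
    have "x \<in> S" "y \<in> S" using pair_partitionsD(7)[OF V(1) B(1)] xy by auto
    then consider "\<rho> x = k" "\<rho> y \<noteq> k" | "\<rho> y = k" "\<rho> x \<noteq> k" using B(2,3) xy by auto
    then show ?thesis
      using B(1) xy \<open>x \<in> S\<close> \<open>y \<in> S\<close> by cases (metis insert_commute)+
  qed
  have adm: "B \<subseteq> A \<or> B \<inter> A = {} \<and> (\<forall>C\<in>V. \<not> crosses B C)" if "B \<in> V" for B
    using V(2) that by (simp add: admissible_def)
  have False if "{x, y} \<in> V" "x < y" "\<rho> x \<noteq> \<rho> y" for x y
    using that
  proof (induction "y - x" arbitrary: x y rule: less_induct)
    case less
    have xyS: "x \<in> S" "y \<in> S" using pair_partitionsD(7)[OF V(1) less.prems(1)] by auto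
    have "\<rho> x \<le> \<rho> y" using \<rho>(2) xyS less.prems(2) by (auto simp: monotone_on_def)
    then have lt: "\<rho> x < \<rho> y" using less.prems(3) by simp
    have ny: "\<rho> y < n" using \<rho>(1) xyS by auto
    \<comment> \<open>Paired positions share a colour while adjacent runs differ, so
      \<open>y\<close> lies beyond the run following that of \<open>x\<close>; this run is therefore
      enclosed between the two positions.\<close>
    have col: "x \<in> A \<longleftrightarrow> y \<in> A" using adm[OF less.prems(1)] by auto
    have c1: "c (\<rho> x) \<noteq> c (Suc (\<rho> x))" using c(2) lt ny by simp
    then have lt2: "Suc (\<rho> x) < \<rho> y" using lt col c(1) xyS by (metis Suc_lessI)
    then obtain p q where pq: "{p, q} \<in> V" "p \<in> S" "q \<in> S" "\<rho> p = Suc (\<rho> x)" "\<rho> q \<noteq> Suc (\<rho> x)"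
      using leave[of "Suc (\<rho> x)"] ny by auto
    have colp: "(p \<in> A) \<noteq> (x \<in> A)" using c(1)[OF pq(2)] c(1)[OF xyS(1)] c1 pq(4) by simp
    have "\<not> p \<le> x" "\<not> y \<le> p"
      using monotone_onD[OF \<rho>(2) pq(2) xyS(1)] monotone_onD[OF \<rho>(2) xyS(2) pq(2)] lt2 pq(4) by auto
    then have p: "x < p" "p < y" by auto
    have ne: "q \<noteq> p" using pq by auto
    have "q \<noteq> x" "q \<noteq> y"
      using pair_partitions_disjoint[OF V(1) less.prems(1) pq(1)] p by fastforce+
    moreover have "\<not> crosses {x, y} {p, q}"
    \<comment> \<open>Exactly one of the two blocks is coloured by \<open>G\<^sub>0\<close>, and
      admissibility forbids every crossing of that block; the colour of \<open>x\<close> decides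
      which one it is.\<close>
    proof (cases "x \<in> A")
      case True
      then have "\<not> {p, q} \<subseteq> A" using colp by auto
      then show ?thesis using adm[OF pq(1)] less.prems(1) crosses_commute by blast
    next
      case False
      then have "\<not> {x, y} \<subseteq> A" by auto
      then show ?thesis using adm[OF less.prems(1)] pq(1) by blast
    qed
    ultimately have q: "x < q" "q < y"
      using p less.prems(2) ne by (auto simp: crosses_def min_def max_def split: if_splits)
    show False
    proof (cases "p < q")
      case True
      then have "q - p < y - x" using p q by linarith
      then show ?thesis using less.hyps[of q p] True pq by auto
    next
      case False
      then have "p - q < y - x" "q < p" using p q ne by linarith+
      then show ?thesis using less.hyps[of p q] pq by (auto simp: insert_commute)
    qed
  qed
  moreover obtain p q where "{p, q} \<in> V" "\<rho> p = 0" "\<rho> q \<noteq> 0" using leave[of 0] n by auto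
  ultimately show False by (metis insert_commute linorder_neqE_nat)
qed

section \<open>Mixed moments of the free pair\<close>

lemma sorted_list_of_set_append:
  fixes A B :: "'a::linorder set"
  assumes "finite A" "finite B" "\<And>x y. x \<in> A \<Longrightarrow> y \<in> B \<Longrightarrow> x < y"
  shows "sorted_list_of_set (A \<union> B) = sorted_list_of_set A @ sorted_list_of_set B"
proof (rule sorted_distinct_set_unique)
  show "sorted (sorted_list_of_set A @ sorted_list_of_set B)"
    using assms by (auto simp: sorted_append intro: less_imp_le)
  show "distinct (sorted_list_of_set A @ sorted_list_of_set B)"
    using assms by fastforce
qed (use assms in auto)

lemma sorted_list_of_set_insert_max:
  fixes A :: "'a::linorder set"
  assumes "finite A" "\<forall>a\<in>A. a < b"
  shows "sorted_list_of_set (insert b A) = sorted_list_of_set A @ [b]"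
  using sorted_list_of_set_append[of A "{b}"] assms by simp

text \<open>As the positions are distinct, choosing a summand at each of them is the same as
  choosing a subset \<open>A\<close>; the factors need not commute, so each choice keeps the order
  of the list.\<close>

lemma prod_list_map_add:
  fixes u v :: "'i \<Rightarrow> 'a::ring_1"
  assumes "distinct xs"
  shows "prod_list (map (\<lambda>i. u i + v i) xs) =
    (\<Sum>A\<in>Pow (set xs). prod_list (map (\<lambda>i. if i \<in> A then u i else v i) xs))"
  using assms
proof (induction xs)
  case (Cons x xs)
  let ?p = "\<lambda>A ys. prod_list (map (\<lambda>i. if i \<in> A then u i else v i) ys)"
  have x: "x \<notin> set xs" using Cons.prems by simp
  have inj: "inj_on (insert x) (Pow (set xs))" using x by (auto simp: inj_on_def)
  have 1: "?p (insert x A) (x # xs) = u x * ?p A xs" "?p A (x # xs) = v x * ?p A xs"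
    if "A \<in> Pow (set xs)" for A
  proof -
    have "map (\<lambda>i. if i \<in> insert x A then u i else v i) xs = map (\<lambda>i. if i \<in> A then u i else v i) xs"
      using x by (intro map_cong) auto
    then show "?p (insert x A) (x # xs) = u x * ?p A xs"
      by (simp only: list.map prod_list.Cons insertI1 if_True)
    show "?p A (x # xs) = v x * ?p A xs" using that x by auto
  qed
  have "(\<Sum>A\<in>Pow (set (x # xs)). ?p A (x # xs)) =
      (\<Sum>A\<in>Pow (set xs). ?p A (x # xs)) + (\<Sum>A\<in>insert x ` Pow (set xs). ?p A (x # xs))"
    unfolding list.set(2) Pow_insert using x by (intro sum.union_disjoint) auto
  also have "\<dots> = (\<Sum>A\<in>Pow (set xs). v x * ?p A xs) + (\<Sum>A\<in>Pow (set xs). u x * ?p A xs)"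
    unfolding sum.reindex[OF inj] comp_def
    by (intro arg_cong2[where f = "(+)"] sum.cong refl) (auto simp only: 1)
  also have "\<dots> = (u x + v x) * (\<Sum>A\<in>Pow (set xs). ?p A xs)"
    by (simp add: distrib_right sum.distrib sum_distrib_left add.commute)
  also have "\<dots> = prod_list (map (\<lambda>i. u i + v i) (x # xs))"
    using Cons by simp
  finally show ?case by simp
qed simp

context unital_star_algebra
begin

lemma prod_list_map_scl:
  assumes "distinct xs"
  shows "prod_list (map (\<lambda>i. if i \<in> A then scl p (u i) else scl q (v i)) xs) =
    scl (p ^ card (set xs \<inter> A) * q ^ card (set xs - A))
      (prod_list (map (\<lambda>i. if i \<in> A then u i else v i) xs))"
  using assms
  by (induction xs) (auto simp: scl_mult_left scl_mult_right insert_Diff_if mult_ac)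

text \<open>Linearity in the single factor at \<open>k\<close>: where the multiple of 1 is chosen,
  the factor disappears and \<open>k\<close> drops out of the list.\<close>

lemma prod_list_map_centre:
  assumes "distinct xs" "k \<in> set xs" "z k = z' k + scl c 1"
    and "\<And>j. j \<noteq> k \<Longrightarrow> z j = z' j"
  shows "prod_list (map z xs) = prod_list (map z' xs) + scl c (prod_list (map z (remove1 k xs)))"
proof -
  obtain ys zs where xs: "xs = ys @ k # zs" using assms(2) by (meson split_list)
  then have k: "k \<notin> set ys" "k \<notin> set zs" using assms(1) by auto
  then have "map z ys = map z' ys" "map z zs = map z' zs"
    by (auto intro!: map_cong assms(4))
  with k show ?thesis
    using xs assms(3) by (simp add: remove1_append distrib_left distrib_right scl_mult_left scl_mult_right
        del: map_eq_conv)
qed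

end

section \<open>Moments of coloured words\<close>

locale free_strong_gaussian_pair = probability_system scl star \<epsilon>
  for scl :: "complex \<Rightarrow> 'a::ring_1 \<Rightarrow> 'a" and star :: "'a \<Rightarrow> 'a" and \<epsilon> :: "'a \<Rightarrow> complex" +
  fixes G G\<^sub>0 :: "'h::{real_inner,complete_space} \<Rightarrow> 'a"
    and t :: "nat set set \<Rightarrow> complex"
  assumes strong: "strong_gaussian_process star \<epsilon> t G"
    and free_gaussian: "free_gaussian_process star \<epsilon> G\<^sub>0"
    and free: "freely_independent scl \<epsilon> (\<lambda>c::bool. if c then range G else range G\<^sub>0)"
begin

lemma state_add: "\<epsilon> (x + y) = \<epsilon> x + \<epsilon> y"
  and state_scl: "\<epsilon> (scl c x) = c * \<epsilon> x"
  and state_diff: "\<epsilon> (x - y) = \<epsilon> x - \<epsilon> y"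
  and state_sum: "\<epsilon> (sum g I) = (\<Sum>i\<in>I. \<epsilon> (g i))"
proof -
  interpret module_hom scl "(*)" \<epsilon>
    using state_linear by (simp add: Vector_Spaces.linear_def)
  show "\<epsilon> (x + y) = \<epsilon> x + \<epsilon> y" "\<epsilon> (scl c x) = c * \<epsilon> x" "\<epsilon> (x - y) = \<epsilon> x - \<epsilon> y"
    "\<epsilon> (sum g I) = (\<Sum>i\<in>I. \<epsilon> (g i))"
    by (fact add scale diff sum)+
qed

lemma t_multiplicative: "strongly_multiplicative t"
  and t_pair: "t {{1, 2}} = 1"
  using strong by (auto simp: strong_gaussian_process_def gaussian_process_def)

definition coloured :: "nat set \<Rightarrow> (nat \<Rightarrow> 'h) \<Rightarrow> nat \<Rightarrow> 'a" where
  "coloured A f i = (if i \<in> A then G (f i) else G\<^sub>0 (f i))"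

definition coloured_word :: "nat set \<Rightarrow> (nat \<Rightarrow> 'h) \<Rightarrow> nat set \<Rightarrow> 'a" where
  "coloured_word A f S = prod_list (map (coloured A f) (sorted_list_of_set S))"

text \<open>If all positions carry \<open>G\<close>, every pair partition is admissible. If all
  carry \<open>G\<^sub>0\<close>, the admissible ones are the non-crossing ones, on which both
  weights equal 1.\<close>

lemma moment_monochromatic:
  assumes S: "finite S" and mono: "S \<subseteq> A \<or> S \<inter> A = {}"
  shows "\<epsilon> (coloured_word A f S) = mixed_sum t f A {} S"
  using mono
proof
  assume A: "S \<subseteq> A"
  have "map (coloured A f) (sorted_list_of_set S) = map (\<lambda>i. G (f i)) (sorted_list_of_set S)"
    using A S by (auto simp: coloured_def)
  moreover have "{V \<in> pair_partitions S. admissible A V \<and> (\<forall>I\<in>{}. \<not> separates I V)} = pair_partitions S"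
    using A pair_partitionsD(7) unfolding admissible_def by fastforce
  ultimately show ?thesis
    using gaussian_process_moment[of star \<epsilon> t G S f] strong S state_one
    by (simp add: coloured_word_def mixed_sum_def strong_gaussian_process_def del: map_eq_conv)
next
  assume A: "S \<inter> A = {}"
  let ?t\<^sub>0 = "\<lambda>V. if noncrossing V then 1 else 0"
  have "\<epsilon> (coloured_word A f S) = \<epsilon> (prod_list (map (\<lambda>i. G\<^sub>0 (f i)) (sorted_list_of_set S)))"
  proof -
    have "map (coloured A f) (sorted_list_of_set S) = map (\<lambda>i. G\<^sub>0 (f i)) (sorted_list_of_set S)"
      using A S by (auto simp: coloured_def)
    then show ?thesis by (simp add: coloured_word_def del: map_eq_conv)
  qed
  also have "\<dots> = (\<Sum>V\<in>pair_partitions S. weight ?t\<^sub>0 V * pairing f V)"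
    by (rule gaussian_process_moment[OF free_gaussian[unfolded free_gaussian_process_def] state_one S])
  also have "\<dots> = mixed_sum t f A {} S"
    unfolding mixed_sum_def
  proof (rule sum.mono_neutral_cong_right)
    show "finite (pair_partitions S)" using S by (rule finite_pair_partitions)
    have adm: "admissible A V \<longleftrightarrow> noncrossing V" if V: "V \<in> pair_partitions S" for V
    proof -
      have "B \<inter> A = {}" "\<not> B \<subseteq> A" if "B \<in> V" for B
        using that pair_partitionsD(6,7)[OF V that] A by auto
      then show ?thesis unfolding admissible_def noncrossing_def by auto
    qed
    have w: "weight ?t\<^sub>0 V = (if noncrossing V then 1 else 0)" if V: "V \<in> pair_partitions S" for V
    proof (cases "V = {}")
      case False
      have "crosses (rank_in S ` B) (rank_in S ` C) \<longleftrightarrow> crosses B C" if "B \<in> V" "C \<in> V" for B C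
        using that by (intro crosses_image[OF rank_in_props(1)[OF S]] pair_partitionsD(5-7)[OF V])
      then have "noncrossing (standardize V) \<longleftrightarrow> noncrossing V"
        using standardize_eq_rank_in_image[OF V] by (simp add: noncrossing_def)
      then show ?thesis using False by (simp add: weight_def)
    qed (simp add: weight_def noncrossing_def)
    show "\<forall>V\<in>pair_partitions S - {V \<in> pair_partitions S. admissible A V \<and> (\<forall>I\<in>{}. \<not> separates I V)}.
        weight ?t\<^sub>0 V * pairing f V = 0"
      using adm w by auto
    show "weight ?t\<^sub>0 V * pairing f V = weight t V * pairing f V"
      if "V \<in> {V \<in> pair_partitions S. admissible A V \<and> (\<forall>I\<in>{}. \<not> separates I V)}" for V
      using that adm w weight_noncrossing[OF t_multiplicative t_pair S, of V] by auto
  qed auto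
  finally show ?thesis .
qed

lemma coloured_word_Union:
  fixes R :: "nat \<Rightarrow> nat set"
  assumes "finite K" "\<And>k. k \<in> K \<Longrightarrow> finite (R k)"
    and "\<And>j k x y. \<lbrakk>j \<in> K; k \<in> K; j < k; x \<in> R j; y \<in> R k\<rbrakk> \<Longrightarrow> x < y"
  shows "prod_list (map (\<lambda>k. coloured_word A f (R k)) (sorted_list_of_set K)) =
    coloured_word A f (\<Union>k\<in>K. R k)"
  using assms
proof (induction K rule: finite_linorder_max_induct)
  case empty
  then show ?case by (simp add: coloured_word_def)
next
  case (insert b K)
  have "(\<Union>k\<in>insert b K. R k) = (\<Union>k\<in>K. R k) \<union> R b" by auto
  moreover have "sorted_list_of_set ((\<Union>k\<in>K. R k) \<union> R b) =
      sorted_list_of_set (\<Union>k\<in>K. R k) @ sorted_list_of_set (R b)"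
  proof (rule sorted_list_of_set_append)
    show "finite (\<Union>k\<in>K. R k)" "finite (R b)" using insert.hyps(1) insert.prems(1) by auto
    show "x < y" if "x \<in> (\<Union>k\<in>K. R k)" "y \<in> R b" for x y
      using that insert.hyps(2) insert.prems(2)[of _ b x y] by auto
  qed
  moreover have "prod_list (map (\<lambda>k. coloured_word A f (R k)) (sorted_list_of_set K)) =
      coloured_word A f (\<Union>k\<in>K. R k)"
  proof (rule insert.IH)
    show "finite (R k)" if "k \<in> K" for k using that insert.prems(1) by simp
    show "x < y" if "j \<in> K" "k \<in> K" "j < k" "x \<in> R j" "y \<in> R k" for j k x y
      using that insert.prems(2)[of j k x y] by simp
  qed
  ultimately show ?case
    using sorted_list_of_set_insert_max[OF insert.hyps] by (simp add: coloured_word_def)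
qed

lemma coloured_word_in_generated_subalgebra:
  assumes "finite S" "\<And>x. x \<in> S \<Longrightarrow> x \<in> A \<longleftrightarrow> c"
  shows "coloured_word A f S \<in> generated_subalgebra scl (if c then range G else range G\<^sub>0)"
proof -
  have "prod_list (map (coloured A f) xs) \<in> generated_subalgebra scl (if c then range G else range G\<^sub>0)"
    if "set xs \<subseteq> S" for xs
    using that
  proof (induction xs)
    case Nil
    then show ?case by (simp add: generated_subalgebra.one)
  next
    case (Cons x xs)
    have "coloured A f x \<in> (if c then range G else range G\<^sub>0)"
      using Cons.prems assms(2)[of x] by (auto simp: coloured_def)
    then have "coloured A f x \<in> generated_subalgebra scl (if c then range G else range G\<^sub>0)"
      by (rule generated_subalgebra.generator)
    then show ?case
      using Cons by (simp add: generated_subalgebra.mult)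
  qed
  then show ?thesis using assms(1) by (simp add: coloured_word_def)
qed

text \<open>Centring a run adds on both sides the same correction: the moment of the run times the mixed
  moment of the remaining runs. When all runs are centred, the left-hand side vanishes by freeness
  and the right-hand side because an admissible pair partition always separates some run.\<close>

lemma mixed_moment:
  assumes "finite S"
  shows "\<epsilon> (coloured_word A f S) = mixed_sum t f A {} S"
  using assms
proof (induction S rule: finite_psubset_induct)
  case (psubset S)
  obtain n \<rho> c where \<rho>: "\<rho> ` S = {..<n}" "mono_on S \<rho>"
    and c: "\<And>x. x \<in> S \<Longrightarrow> c (\<rho> x) \<longleftrightarrow> x \<in> A" "\<And>k. Suc k < n \<Longrightarrow> c k \<noteq> c (Suc k)"
    using monochromatic_runs[OF psubset.hyps(1), of A] by metis
  define R where "R k = {x \<in> S. \<rho> x = k}" for k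
  define N where "N = {..<n}"
  define w where "w k = coloured_word A f (R k)" for k
  \<comment> \<open>Below, \<open>K\<close> is the set of runs still present and \<open>F\<close>
    the set of centred ones; \<open>E\<close> and \<open>M\<close> are the algebraic and the
    combinatorial value to be matched.\<close>
  define z where "z F k = w k - (if k \<in> F then scl (\<epsilon> (w k)) 1 else 0)" for F k
  define E where "E K F = \<epsilon> (prod_list (map (z F) (sorted_list_of_set K)))" for K F
  define M where "M K F = mixed_sum t f A (R ` F) (\<Union>k\<in>K. R k)" for K F
  have finR: "finite (R k)" and subR: "R k \<subseteq> S" for k using psubset.hyps by (auto simp: R_def)
  have finN: "finite K" if "K \<subseteq> N" for K using that finite_subset by (auto simp: N_def)
  have neR: "R k \<noteq> {}" if "k \<in> N" for k
  proof -
    have "k \<in> \<rho> ` S" using that \<rho>(1) by (simp add: N_def)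
    then show ?thesis by (auto simp: R_def)
  qed
  have UnN: "(\<Union>k\<in>N. R k) = S"
    using \<rho>(1) by (auto simp: R_def N_def)
  have lessR: "x < y" if "j < k" "x \<in> R j" "y \<in> R k" for j k x y
    using that monotone_onD[OF \<rho>(2), of y x] by (force simp: R_def)
  have Ew: "\<epsilon> (w k) = mixed_sum t f A {} (R k)" for k
  proof -
    have "R k \<subseteq> A \<or> R k \<inter> A = {}" by (cases "c k") (auto simp: R_def simp flip: c(1))
    then show ?thesis unfolding w_def using finR by (rule moment_monochromatic[rotated])
  qed
  have E_split: "E K F = E K (insert k F) + \<epsilon> (w k) * E (K - {k}) F"
    if "K \<subseteq> N" "k \<in> K" "k \<notin> F" for K F k
  proof -
    have "prod_list (map (z F) (sorted_list_of_set K)) =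
        prod_list (map (z (insert k F)) (sorted_list_of_set K)) +
        scl (\<epsilon> (w k)) (prod_list (map (z F) (remove1 k (sorted_list_of_set K))))"
      using that finN[OF that(1)] by (intro prod_list_map_centre) (auto simp: z_def)
    moreover have "remove1 k (sorted_list_of_set K) = sorted_list_of_set (K - {k})"
      using finN[OF that(1)] by (simp add: sorted_list_of_set_remove)
    ultimately show ?thesis by (simp add: E_def state_add state_scl)
  qed
  have M_split: "M K F = M K (insert k F) + \<epsilon> (w k) * M (K - {k}) F"
    if "K \<subseteq> N" "F \<subseteq> K" "k \<in> K" "k \<notin> F" for K F k
  proof -
    have "(\<Union>j\<in>K. R j) - R k = (\<Union>j\<in>K - {k}. R j)" by (auto simp: R_def)
    moreover have "mixed_sum t f A (R ` F) (\<Union>j\<in>K. R j) =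
        mixed_sum t f A (insert (R k) (R ` F)) (\<Union>j\<in>K. R j) +
        mixed_sum t f A {} (R k) * mixed_sum t f A (R ` F) ((\<Union>j\<in>K. R j) - R k)"
    proof (rule mixed_sum_split[OF t_multiplicative])
      show "finite (\<Union>j\<in>K. R j)" using finN[OF that(1)] finR by auto
      show "R k \<subseteq> (\<Union>j\<in>K. R j)" using that by auto
      show "J \<inter> R k = {}" if "J \<in> R ` F" for J using that \<open>k \<notin> F\<close> by (auto simp: R_def)
      show "y \<in> R k" if "x \<in> R k" "v \<in> R k" "y \<in> (\<Union>j\<in>K. R j)" "x < y" "y < v" for x y v
      proof -
        from that(3) obtain j where j: "y \<in> R j" by auto
        have "\<not> j < k" "\<not> k < j"
          using lessR[of j k y x] lessR[of k j v y] j that by auto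
        then show ?thesis using j by (metis linorder_neqE_nat)
      qed
    qed
    ultimately show ?thesis by (simp add: M_def Ew)
  qed
  have E_empty: "E K {} = \<epsilon> (coloured_word A f (\<Union>k\<in>K. R k))" if "K \<subseteq> N" for K
  proof -
    have "z {} = (\<lambda>k. coloured_word A f (R k))" by (auto simp: z_def w_def)
    moreover have "prod_list (map (\<lambda>k. coloured_word A f (R k)) (sorted_list_of_set K)) =
        coloured_word A f (\<Union>k\<in>K. R k)"
      by (rule coloured_word_Union) (use finN[OF that] finR in \<open>auto intro: lessR\<close>)
    ultimately show ?thesis by (simp only: E_def)
  qed
  \<comment> \<open>Since runs are non-empty, omitting one leaves a proper subset of
    \<open>S\<close>, to which the outer induction applies whether or not its colours still
    alternate along \<open>K\<close>. Centring is then introduced run by run.\<close>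
  have below: "E K F = M K F" if "F \<subseteq> K" "K \<subset> N" for K F
  proof -
    have "finite F" using that finN finite_subset by blast
    then show ?thesis using that
    proof (induction F arbitrary: K rule: finite_induct)
      case empty
      obtain k where "k \<in> N" "k \<notin> K" using empty by auto
      then have "(\<Union>k\<in>K. R k) \<subset> S"
        using neR[of k] subR by (auto simp: R_def)
      then have "\<epsilon> (coloured_word A f (\<Union>k\<in>K. R k)) = M K {}"
        unfolding M_def by (simp add: psubset.IH)
      moreover have "E K {} = \<epsilon> (coloured_word A f (\<Union>k\<in>K. R k))"
        using empty by (intro E_empty) auto
      ultimately show ?case by simp
    next
      case (insert k F)
      have K: "F \<subseteq> K" "K \<subset> N" "k \<in> K" using insert.prems by auto
      have "E K F = M K F" using K(1,2) by (rule insert.IH)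
      moreover have "E (K - {k}) F = M (K - {k}) F"
        using K insert.hyps(2) by (intro insert.IH) auto
      moreover have "E K F = E K (insert k F) + \<epsilon> (w k) * E (K - {k}) F"
        using K insert.hyps(2) by (intro E_split) auto
      moreover have "M K F = M K (insert k F) + \<epsilon> (w k) * M (K - {k}) F"
        using K insert.hyps(2) by (intro M_split) auto
      ultimately show ?case by simp
    qed
  qed
  show ?case
  \<comment> \<open>Freeness concerns products of at least one factor, so the empty word is treated
    apart.\<close>
  proof (cases "n = 0")
    case True
    then have "S = {}" using \<rho>(1) by simp
    then show ?thesis using psubset.hyps by (intro moment_monochromatic) simp_all
  next
    case False
    have "\<forall>k<n. z N k \<in> generated_subalgebra scl (if c k then range G else range G\<^sub>0) \<and> \<epsilon> (z N k) = 0"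
    proof (intro allI impI)
      fix k assume k: "k < n"
      let ?U = "generated_subalgebra scl (if c k then range G else range G\<^sub>0)"
      have "w k \<in> ?U"
        unfolding w_def
        by (rule coloured_word_in_generated_subalgebra[OF finR]) (auto simp: R_def c(1))
      \<comment> \<open>Subtraction is rewritten as adding a multiple of 1, to match the closure
        rules of \<open>generated_subalgebra\<close>.\<close>
      moreover have "z N k = w k + scl (- \<epsilon> (w k)) 1" using k by (simp add: z_def N_def)
      ultimately have "z N k \<in> ?U"
        using generated_subalgebra.add generated_subalgebra.scaled generated_subalgebra.one by metis
      moreover have "\<epsilon> (z N k) = 0" using k by (simp add: z_def N_def state_diff state_scl state_one)
      ultimately show "z N k \<in> ?U \<and> \<epsilon> (z N k) = 0" by blast
    qed
    then have "\<epsilon> (prod_list (map (z N) [0..<n])) = 0"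
      using free[unfolded freely_independent_def, rule_format, of n "z N" c] False c(2) by auto
    moreover have "sorted_list_of_set N = [0..<n]"
      by (simp add: N_def lessThan_atLeast0)
    ultimately have "E N N = 0" by (simp add: E_def)
    moreover have "M N N = 0"
    proof -
      have "\<exists>k<n. separates (R k) V" if "V \<in> pair_partitions S" "admissible A V" for V
        unfolding R_def using False that \<rho> c by (intro admissible_separates_run[where A = A and c = c]) auto
      then have "{V \<in> pair_partitions S. admissible A V \<and> (\<forall>I\<in>R ` N. \<not> separates I V)} = {}"
        by (auto simp: N_def)
      then show ?thesis by (simp only: M_def UnN mixed_sum_def sum.empty)
    qed
    ultimately have top: "E N N = M N N" by simp
    \<comment> \<open>\<open>D\<close> collects the runs whose centring has been undone, starting
      from all runs centred. Each correction term lacks a run and is known from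
      \<open>below\<close>.\<close>
    have "E N (N - D) = M N (N - D)" if "D \<subseteq> N" for D
      using finN[OF that] that
    proof (induction D rule: finite_induct)
      case empty
      then show ?case using top by simp
    next
      case (insert k D)
      let ?F = "N - insert k D"
      have "insert k ?F = N - D" using insert by auto
      moreover have k: "k \<in> N" "D \<subseteq> N" using insert.prems by auto
      moreover have "E (N - {k}) ?F = M (N - {k}) ?F" using k by (intro below) auto
      moreover have "E N ?F = E N (insert k ?F) + \<epsilon> (w k) * E (N - {k}) ?F"
        using k by (intro E_split) auto
      moreover have "M N ?F = M N (insert k ?F) + \<epsilon> (w k) * M (N - {k}) ?F"
        using k by (intro M_split) auto
      ultimately show ?case using insert.IH by simp
    qed
    then have "E N {} = M N {}" by (metis Diff_cancel order_refl)
    moreover have "E N {} = \<epsilon> (coloured_word A f S)"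
      using E_empty[of N] UnN by simp
    ultimately show ?thesis by (simp add: M_def UnN)
  qed
qed

end

section \<open>Summation over colourings\<close>

text \<open>An admissible colouring is the union of all crossing blocks and of a freely chosen set
  \<open>D\<close> of singletons. Each block holds two positions, whence the squares of
  \<open>p\<close> and \<open>q\<close>.\<close>

lemma sum_admissible_colourings:
  fixes p q :: complex
  assumes S: "finite S" and V: "V \<in> pair_partitions S" and pq: "p\<^sup>2 + q\<^sup>2 = 1"
  shows "(\<Sum>A\<in>{A \<in> Pow S. admissible A V}. p ^ card A * q ^ card (S - A)) =
    (p\<^sup>2) ^ nonsingleton_count V"
proof -
  define N where "N = {B \<in> V. \<exists>C\<in>V. crosses B C}"
  \<comment> \<open>The set \<open>H\<close> consists of the singletons; the exponent H(V) of the
    theorem is the size of \<open>N\<close>.\<close>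
  define H where "H = V - N"
  have fin: "finite V" using finite_pair_partition[OF S V] .
  then have finH: "finite H" and finN: "finite N" by (auto simp: H_def N_def)
  have card_Union: "card (\<Union>W) = 2 * card W" if "W \<subseteq> V" for W
    using card_pair_partition[OF pair_partitions_subset[OF V that]] .
  have mem: "B \<subseteq> \<Union>W \<longleftrightarrow> B \<in> W" "B \<inter> \<Union>W = {} \<longleftrightarrow> B \<notin> W" if B: "B \<in> V" and W: "W \<subseteq> V" for B W
  proof -
    have *: "B \<in> W" if "x \<in> B" "x \<in> \<Union>W" for x
      using that W pair_partitions_disjoint[OF V B] by blast
    obtain x where "x \<in> B" using pair_partitionsD(6)[OF V B] by auto
    then show "B \<subseteq> \<Union>W \<longleftrightarrow> B \<in> W" using *[of x] by (metis Union_upper subsetD)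
    show "B \<inter> \<Union>W = {} \<longleftrightarrow> B \<notin> W"
      using * \<open>x \<in> B\<close> by (metis UnionI disjoint_iff)
  qed
  have bij: "bij_betw (\<lambda>D. \<Union>(N \<union> D)) (Pow H) {A \<in> Pow S. admissible A V}"
  proof (rule bij_betw_byWitness[where f' = "\<lambda>A. {B \<in> H. B \<subseteq> A}"])
    have sub: "N \<union> D \<subseteq> V" if "D \<subseteq> H" for D using that by (auto simp: N_def H_def)
    show "\<forall>D\<in>Pow H. {B \<in> H. B \<subseteq> \<Union>(N \<union> D)} = D"
    proof
      fix D assume D: "D \<in> Pow H"
      then have "B \<subseteq> \<Union>(N \<union> D) \<longleftrightarrow> B \<in> D" if "B \<in> H" for B
        using mem(1)[of B "N \<union> D"] sub[of D] that by (auto simp: H_def)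
      then show "{B \<in> H. B \<subseteq> \<Union>(N \<union> D)} = D" using D by auto
    qed
    show "\<forall>A\<in>{A \<in> Pow S. admissible A V}. \<Union>(N \<union> {B \<in> H. B \<subseteq> A}) = A"
    proof clarify
      fix A assume A: "A \<subseteq> S" "admissible A V"
      have adm: "B \<subseteq> A \<or> B \<inter> A = {} \<and> (\<forall>C\<in>V. \<not> crosses B C)" if "B \<in> V" for B
        using A(2) that by (simp add: admissible_def)
      show "\<Union>(N \<union> {B \<in> H. B \<subseteq> A}) = A"
      proof (intro equalityI subsetI)
        fix x assume "x \<in> \<Union>(N \<union> {B \<in> H. B \<subseteq> A})"
        then obtain B where B: "x \<in> B" "B \<in> N \<or> B \<subseteq> A" by auto
        then have "B \<subseteq> A" using adm[of B] by (auto simp: N_def)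
        then show "x \<in> A" using B(1) by auto
      next
        fix x assume x: "x \<in> A"
        then obtain B where B: "B \<in> V" "x \<in> B"
          using A(1) pair_partitionsD(1)[OF V] by (metis Union_iff subsetD)
        then have "B \<subseteq> A" using adm[OF B(1)] x by auto
        then show "x \<in> \<Union>(N \<union> {B \<in> H. B \<subseteq> A})" using B by (auto simp: H_def)
      qed
    qed
    show "(\<lambda>D. \<Union>(N \<union> D)) ` Pow H \<subseteq> {A \<in> Pow S. admissible A V}"
    proof clarify
      fix D assume "D \<subseteq> H"
      then have D: "N \<union> D \<subseteq> V" by (rule sub)
      have "\<Union>(N \<union> D) \<subseteq> S" using D pair_partitionsD(7)[OF V] by blast
      moreover have "admissible (\<Union>(N \<union> D)) V"
        unfolding admissible_def
      proof
        fix B assume B: "B \<in> V"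
        show "B \<subseteq> \<Union>(N \<union> D) \<or> B \<inter> \<Union>(N \<union> D) = {} \<and> (\<forall>C\<in>V. \<not> crosses B C)"
          unfolding mem[OF B D] using B by (auto simp: N_def)
      qed
      ultimately show "\<Union>(N \<union> D) \<in> Pow S \<and> admissible (\<Union>(N \<union> D)) V" by blast
    qed
    show "(\<lambda>A. {B \<in> H. B \<subseteq> A}) ` {A \<in> Pow S. admissible A V} \<subseteq> Pow H" by auto
  qed
  have "(\<Sum>A\<in>{A \<in> Pow S. admissible A V}. p ^ card A * q ^ card (S - A)) =
      (\<Sum>D\<in>Pow H. p ^ card (\<Union>(N \<union> D)) * q ^ card (S - \<Union>(N \<union> D)))"
    by (rule sum.reindex_bij_betw[OF bij, symmetric])
  also have "\<dots> = (\<Sum>D\<in>Pow H. (p\<^sup>2) ^ card N * ((\<Prod>x\<in>D. p\<^sup>2) * (\<Prod>x\<in>H - D. q\<^sup>2)))"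
  proof (rule sum.cong[OF refl])
    fix D assume D: "D \<in> Pow H"
    then have sub: "N \<union> D \<subseteq> V" "finite D" "N \<inter> D = {}"
      using finH finite_subset by (auto simp: N_def H_def)
    have "S - \<Union>(N \<union> D) = \<Union>(H - D)"
    proof (intro equalityI subsetI)
      fix x assume x: "x \<in> S - \<Union>(N \<union> D)"
      then obtain B where "B \<in> V" "x \<in> B" using pair_partitionsD(1)[OF V] by (metis DiffD1 Union_iff)
      then show "x \<in> \<Union>(H - D)" using x by (auto simp: H_def)
    next
      fix x assume "x \<in> \<Union>(H - D)"
      then obtain B where B: "B \<in> H" "B \<notin> D" "x \<in> B" by auto
      then have "B \<inter> \<Union>(N \<union> D) = {}" using mem(2)[OF _ sub(1), of B] by (auto simp: H_def)
      moreover have "x \<in> S" using B pair_partitionsD(7)[OF V, of B] by (auto simp: H_def)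
      ultimately show "x \<in> S - \<Union>(N \<union> D)" using B(3) by blast
    qed
    then have "card (S - \<Union>(N \<union> D)) = 2 * card (H - D)"
      using card_Union[of "H - D"] by (auto simp: H_def)
    moreover have "card (\<Union>(N \<union> D)) = 2 * (card N + card D)"
      using card_Union[OF sub(1)] sub finN by (simp add: card_Un_disjoint)
    ultimately show "p ^ card (\<Union>(N \<union> D)) * q ^ card (S - \<Union>(N \<union> D)) =
        (p\<^sup>2) ^ card N * ((\<Prod>x\<in>D. p\<^sup>2) * (\<Prod>x\<in>H - D. q\<^sup>2))"
      by (simp only: power_mult power_add prod_constant mult.assoc)
  qed
  \<comment> \<open>The sum over \<open>D\<close> is the expansion of a product of binomials, one
    for each singleton.\<close>
  also have "\<dots> = (p\<^sup>2) ^ card N * (\<Prod>x\<in>H. p\<^sup>2 + q\<^sup>2)"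
    by (simp only: prod_add[OF finH] sum_distrib_left)
  also have "\<dots> = (p\<^sup>2) ^ nonsingleton_count V"
    by (simp add: pq nonsingleton_count_eq[OF fin] N_def)
  finally show ?thesis .
qed

section \<open>Moments of the interpolated process\<close>

context free_strong_gaussian_pair
begin

lemma interpolated_moment:
  fixes f :: "nat \<Rightarrow> 'h" and p q :: complex
  assumes S: "finite S" and pq: "p\<^sup>2 + q\<^sup>2 = 1"
  shows "\<epsilon> (prod_list (map (\<lambda>i. scl p (G (f i)) + scl q (G\<^sub>0 (f i))) (sorted_list_of_set S))) =
    (\<Sum>V\<in>pair_partitions S. (p\<^sup>2) ^ nonsingleton_count V * weight t V * pairing f V)"
proof -
  let ?xs = "sorted_list_of_set S"
  have "\<epsilon> (prod_list (map (\<lambda>i. scl p (G (f i)) + scl q (G\<^sub>0 (f i))) ?xs)) =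
      (\<Sum>A\<in>Pow S. p ^ card (S \<inter> A) * q ^ card (S - A) * \<epsilon> (coloured_word A f S))"
    using S by (simp add: prod_list_map_add prod_list_map_scl state_sum state_scl
        coloured_word_def coloured_def[abs_def])
  also have "\<dots> = (\<Sum>A\<in>Pow S. p ^ card A * q ^ card (S - A) * mixed_sum t f A {} S)"
    by (intro sum.cong refl) (auto simp: mixed_moment[OF S] Int_absorb1)
  also have "\<dots> = (\<Sum>A\<in>Pow S. \<Sum>V\<in>{V \<in> pair_partitions S. admissible A V}.
      p ^ card A * q ^ card (S - A) * (weight t V * pairing f V))"
    by (simp add: mixed_sum_def sum_distrib_left)
  \<comment> \<open>Both double sums run over the pairs of a colouring and a partition admissible
    for it; for fixed \<open>V\<close> the colourings can now be summed.\<close>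
  also have "\<dots> = (\<Sum>V\<in>pair_partitions S. \<Sum>A\<in>{A \<in> Pow S. admissible A V}.
      p ^ card A * q ^ card (S - A) * (weight t V * pairing f V))"
    using S finite_pair_partitions[OF S] by (intro sum.swap_restrict) auto
  also have "\<dots> = (\<Sum>V\<in>pair_partitions S. (p\<^sup>2) ^ nonsingleton_count V * (weight t V * pairing f V))"
    using S pq by (intro sum.cong refl)
      (simp only: sum_distrib_right[symmetric] sum_admissible_colourings)
  finally show ?thesis by (simp only: mult.assoc)
qed

end

theorem theorem3:
  fixes scl :: "complex \<Rightarrow> 'a::ring_1 \<Rightarrow> 'a"
    and star :: "'a \<Rightarrow> 'a"
    and \<epsilon> :: "'a \<Rightarrow> complex"
    and G G\<^sub>0 :: "'h::{real_inner,complete_space} \<Rightarrow> 'a"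
    and t :: "nat set set \<Rightarrow> complex"
    and b :: real
  assumes "probability_system scl star \<epsilon>"
    and "strong_gaussian_process star \<epsilon> t G"
    and "free_gaussian_process star \<epsilon> G\<^sub>0"
    and "freely_independent scl \<epsilon> (\<lambda>c::bool. if c then range G else range G\<^sub>0)"
    and "0 \<le> b" and "b \<le> 1"
  shows "strong_gaussian_process star \<epsilon>
    (\<lambda>V. complex_of_real b ^ nonsingleton_count V * t V)
    (\<lambda>f. scl (complex_of_real (sqrt b)) (G f)
       + scl (complex_of_real (sqrt (1 - b))) (G\<^sub>0 f))"
proof -
  interpret probability_system scl star \<epsilon> by fact
  interpret free_strong_gaussian_pair scl star \<epsilon> G G\<^sub>0 t by unfold_locales fact+
  let ?p = "complex_of_real (sqrt b)" and ?q = "complex_of_real (sqrt (1 - b))"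
  let ?X = "\<lambda>f. scl ?p (G f) + scl ?q (G\<^sub>0 f)"
  \<comment> \<open>The range of \<open>b\<close> enters here: it makes both radicands
    non-negative.\<close>
  have p2: "?p\<^sup>2 = complex_of_real b" and q2: "?q\<^sup>2 = complex_of_real (1 - b)"
    using assms(5,6) by (simp_all flip: of_real_power)
  have pq: "?p\<^sup>2 + ?q\<^sup>2 = 1" unfolding p2 q2 by simp
  have moment: "\<epsilon> (prod_list (map (\<lambda>i. ?X (f i)) [1..<k + 1])) =
      (\<Sum>V\<in>pair_partitions {1..k}. complex_of_real b ^ nonsingleton_count V * weight t V * pairing f V)"
    for f k
    using interpolated_moment[OF _ pq, of "{1..k}" f] unfolding p2
    by (simp add: atLeastLessThanSuc_atLeastAtMost[symmetric] del: of_real_power)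
  have "gaussian_process star \<epsilon> (\<lambda>V. complex_of_real b ^ nonsingleton_count V * t V) ?X"
    unfolding gaussian_process_def
  proof (intro conjI allI impI)
    \<comment> \<open>The only block crosses nothing, so the power of \<open>b\<close> has exponent
      0 and equals 1 even for \<open>b = 0\<close>.\<close>
    have "{B \<in> {{1, 2::nat}}. \<exists>C\<in>{{1, 2}}. crosses B C} = {}" by auto
    then show "complex_of_real b ^ nonsingleton_count {{1, 2::nat}} * t {{1, 2}} = 1"
      using t_pair nonsingleton_count_eq[of "{{1, 2::nat}}"]
      by (simp only: card.empty finite.intros power_0 mult_1)
    \<comment> \<open>Both coefficients are real and hence fixed by the conjugation in
      \<open>star_scl\<close>.\<close>
    show "star (?X f) = ?X f" for f
      using strong free_gaussian
      by (simp add: star_add star_scl strong_gaussian_process_def free_gaussian_process_def gaussian_process_def)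
  next
    fix n :: nat and f :: "nat \<Rightarrow> 'h" assume n: "n \<ge> 1"
    \<comment> \<open>The two can differ only at the empty partition, which \<open>n \<ge> 1\<close>
      excludes.\<close>
    have "weight t V = t V" if "V \<in> pair_partitions {1..2 * n}" for V
    proof -
      have "V \<noteq> {}" using that n card_pair_partition[OF that] by auto
      then show ?thesis using standardize_initial_segment[OF that] by (simp add: weight_def)
    qed
    then show "\<epsilon> (prod_list (map (\<lambda>i. ?X (f i)) [1..<2 * n + 1])) =
        (\<Sum>V\<in>pair_partitions {1..2 * n}. complex_of_real b ^ nonsingleton_count V * t V *
          (\<Prod>B\<in>V. complex_of_real (f (Min B) \<bullet> f (Max B))))"
      unfolding moment pairing_def by simp
  next
    fix k :: nat and f :: "nat \<Rightarrow> 'h" assume "odd k"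
    then have "pair_partitions {1..k} = {}" using card_pair_partition[of _ "{1..k}"] by fastforce
    then show "\<epsilon> (prod_list (map (\<lambda>i. ?X (f i)) [1..<k + 1])) = 0"
      unfolding moment by simp
  qed
  then show ?thesis
    using strongly_multiplicative_nonsingleton_count[OF t_multiplicative]
    by (simp add: strong_gaussian_process_def)
qed

end
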